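(* Let $\kappa=(\kappa_1,\ldots,\kappa_n)\in\mathbb{N}^n$, $f(u,v)\in\mathbb{C}[u_1,\ldots,u_n,v_1,\ldots,v_n]$ and $g(z,w)\in\mathbb{C}[z_1,\ldots,z_n,w_1,\ldots,w_n]$. Suppose that $\deg_{u_i}(f)\le\kappa_i$ and $\deg_{z_i}(g)\le\kappa_i$ for all $i\in\{1,\ldots,n\}$. (a) If $f$ and $g$ are $\mathbb{H}_\theta$-stable for some $0\le\theta<2\pi$, then the polynomial (in $4n$ variables) $$\sum_{\alpha\le\kappa}\frac{\partial^\alpha f}{\partial u^\alpha}(u,v)\cdot\frac{\partial^{\kappa-\alpha}g}{\partial z^{\kappa-\alpha}}(z,w)$$ is $\mathbb{H}_\theta$-stable or identically zero. (b) If $f$ and $g$ are $\mathbb{H}_0$-stable, then the polynomial $$\sum_{\alpha\le\kappa}(-1)^{\alpha}\frac{(\kappa-\alpha)!}{\alpha!}\cdot\frac{\partial^\alpha f}{\partial u^\alpha}(u,v)\cdot\frac{\partial^{\alpha}g}{\partial z^{\alpha}}(z,w)$$ is $\mathbb{H}_0$-stable or identically zero. (c) If $f$ and $g$ are $\mathbb{D}$-stable, then the polynomial $$\sum_{\alpha\le\kappa}\frac{(\kappa-\alpha)!}{\alpha!}\cdot\frac{\partial^\alpha f}{\partial u^\alpha}(0,v)\cdot\frac{\partial^{\alpha}g}{\partial z^{\alpha}}(0,w)$$ is $\mathbb{D}$-stable or identically zero.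
   Context: $\mathbb{N}$ contains $0$; sums run over $\alpha\in\mathbb{N}^n$ with $\alpha_i\le\kappa_i$ for all $i$. $\alpha!=\alpha_1!\cdots\alpha_n!$, $(-1)^\alpha=(-1)^{\alpha_1+\cdots+\alpha_n}$, and $\partial^\alpha/\partial u^\alpha=\partial^{\alpha_1+\cdots+\alpha_n}/\partial u_1^{\alpha_1}\cdots\partial u_n^{\alpha_n}$. $\mathbb{D}$ is the open unit disk and $\mathbb{H}_\theta=\{z\in\mathbb{C}:\mathrm{Im}(e^{i\theta}z)>0\}$. For $\Psi\subset\mathbb{C}$, a polynomial is $\Psi$-stable if it is nonzero whenever all its variables lie in $\Psi$. *)

theory Defs
  imports "HOL-Analysis.Analysis" "HOL-Library.Poly_Mapping"
begin

text \<open>A polynomial over the complex numbers in the variables \<open>'x\<close> is a finitely supported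
  map from monomials (exponent vectors) to coefficients; the ring structure is that of
  \<^theory>\<open>HOL-Library.Poly_Mapping\<close>.\<close>

type_synonym 'x mpoly = "('x \<Rightarrow>\<^sub>0 nat) \<Rightarrow>\<^sub>0 complex"

definition Const :: "complex \<Rightarrow> 'x mpoly" where
  "Const c = Poly_Mapping.single 0 c"

definition Var :: "'x \<Rightarrow> 'x mpoly" where
  "Var i = Poly_Mapping.single (Poly_Mapping.single i 1) 1"

definition mpoly_eval :: "('x \<Rightarrow> complex) \<Rightarrow> 'x mpoly \<Rightarrow> complex" where
  "mpoly_eval x p =
    (\<Sum>m\<in>Poly_Mapping.keys p. Poly_Mapping.lookup p m *
       (\<Prod>i\<in>Poly_Mapping.keys m. x i ^ Poly_Mapping.lookup m i))"

definition mpoly_subst :: "('x \<Rightarrow> 'y mpoly) \<Rightarrow> 'x mpoly \<Rightarrow> 'y mpoly" where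
  "mpoly_subst s p =
    (\<Sum>m\<in>Poly_Mapping.keys p. Const (Poly_Mapping.lookup p m) *
       (\<Prod>i\<in>Poly_Mapping.keys m. s i ^ Poly_Mapping.lookup m i))"

definition rename_vars :: "('x \<Rightarrow> 'y) \<Rightarrow> 'x mpoly \<Rightarrow> 'y mpoly" where
  "rename_vars h = mpoly_subst (\<lambda>i. Var (h i))"

text \<open>The zero polynomial gets degree \<open>0\<close>, so that it satisfies every degree bound.\<close>

definition degree_in :: "'x \<Rightarrow> 'x mpoly \<Rightarrow> nat" where
  "degree_in i p = Max (insert 0 ((\<lambda>m. Poly_Mapping.lookup m i) ` Poly_Mapping.keys p))"

text \<open>Monomials not containing the variable \<open>i\<close> contribute \<open>0\<close> below because of the factor
  \<open>lookup m i\<close>; the truncated subtraction is harmless.\<close>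

definition mpoly_pderiv :: "'x \<Rightarrow> 'x mpoly \<Rightarrow> 'x mpoly" where
  "mpoly_pderiv i p =
    (\<Sum>m\<in>Poly_Mapping.keys p. Poly_Mapping.single (m - Poly_Mapping.single i 1)
       (of_nat (Poly_Mapping.lookup m i) * Poly_Mapping.lookup p m))"

lemma lookup_mpoly_pderiv:
  "Poly_Mapping.lookup (mpoly_pderiv i p) m =
     of_nat (Suc (Poly_Mapping.lookup m i)) * Poly_Mapping.lookup p (m + Poly_Mapping.single i 1)"
proof -
  let ?e = "Poly_Mapping.single i (1::nat)"
  let ?c = "\<lambda>k. of_nat (Poly_Mapping.lookup k i) * Poly_Mapping.lookup p k"
  have shift: "k = m + ?e" if "k - ?e = m" "Poly_Mapping.lookup k i \<noteq> 0" for k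
  proof (rule poly_mapping_eqI)
    fix j
    show "Poly_Mapping.lookup k j = Poly_Mapping.lookup (m + ?e) j"
      using that by (auto simp: lookup_add lookup_minus lookup_single when_def)
  qed
  have "Poly_Mapping.lookup (mpoly_pderiv i p) m =
      (\<Sum>k\<in>Poly_Mapping.keys p. ?c k when k - ?e = m)"
    by (simp add: mpoly_pderiv_def lookup_sum lookup_single)
  also have "\<dots> = (\<Sum>k\<in>Poly_Mapping.keys p. if k = m + ?e then ?c k else 0)"
    using shift by (intro sum.cong) (auto simp: when_def)
  also have "\<dots> = ?c (m + ?e)"
    by (simp add: in_keys_iff)
  finally show ?thesis
    by (simp add: lookup_add)
qed

lemma mpoly_pderiv_commute:
  "mpoly_pderiv i (mpoly_pderiv j p) = mpoly_pderiv j (mpoly_pderiv i p)"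
  by (rule poly_mapping_eqI)
     (auto simp: lookup_mpoly_pderiv lookup_add lookup_single when_def ac_simps)

text \<open>\<open>mpoly_diff s \<alpha>\<close> differentiates \<open>\<alpha> i\<close> times with respect to the variable \<open>s i\<close>, for every
  index \<open>i\<close>. The fold over all indices does not depend on an order, by the lemma that follows.\<close>

definition mpoly_diff :: "('n::finite \<Rightarrow> 'x) \<Rightarrow> ('n \<Rightarrow> nat) \<Rightarrow> 'x mpoly \<Rightarrow> 'x mpoly" where
  "mpoly_diff s \<alpha> p = Finite_Set.fold (\<lambda>i. mpoly_pderiv (s i) ^^ \<alpha> i) p UNIV"

lemma comp_fun_commute_mpoly_pderiv_funpow:
  "comp_fun_commute (\<lambda>i. mpoly_pderiv (s i) ^^ \<alpha> i)"
proof -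
  interpret comp_fun_commute "\<lambda>i. mpoly_pderiv (s i)"
    by standard (simp add: fun_eq_iff mpoly_pderiv_commute)
  show ?thesis
    by (rule comp_fun_commute_funpow)
qed

definition stable :: "complex set \<Rightarrow> 'x mpoly \<Rightarrow> bool" where
  "stable \<Psi> p \<longleftrightarrow> (\<forall>x. (\<forall>i. x i \<in> \<Psi>) \<longrightarrow> mpoly_eval x p \<noteq> 0)"

definition half_plane :: "real \<Rightarrow> complex set" where
  "half_plane \<theta> = {z. Im (exp (\<i> * of_real \<theta>) * z) > 0}"

definition unit_disk :: "complex set" where
  "unit_disk = ball 0 1"

definition multi_fact :: "('n::finite \<Rightarrow> nat) \<Rightarrow> complex" where
  "multi_fact \<alpha> = (\<Prod>i\<in>UNIV. fact (\<alpha> i))"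

definition multi_sign :: "('n::finite \<Rightarrow> nat) \<Rightarrow> complex" where
  "multi_sign \<alpha> = (-1) ^ (\<Sum>i\<in>UNIV. \<alpha> i)"

text \<open>The order on multi-indices is the pointwise one, and there are only finitely many
  multi-indices below a given one, so sums over \<open>{..\<kappa>}\<close> are honest sums.\<close>

lemma finite_atMost_multi_index: "finite {..\<kappa> :: 'n::finite \<Rightarrow> nat}"
proof -
  have "{..\<kappa>} = PiE UNIV (\<lambda>i. {..\<kappa> i})"
    by (auto simp: le_fun_def PiE_def Pi_def)
  then show ?thesis
    by (simp add: finite_PiE)
qed

text \<open>In a polynomial in two blocks of variables indexed by \<open>'n\<close>, the first block is \<open>Inl i\<close> and
  the second \<open>Inr i\<close>: for \<open>f\<close> these are \<open>u\<close> and \<open>v\<close>, for \<open>g\<close> they are \<open>z\<close> and \<open>w\<close>. Polynomials in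
  all four blocks use \<open>Inl (Inl i)\<close>, \<open>Inl (Inr i)\<close>, \<open>Inr (Inl i)\<close>, \<open>Inr (Inr i)\<close> for \<open>u\<close>, \<open>v\<close>,
  \<open>z\<close>, \<open>w\<close>.

  \<open>first_block_zero p\<close> is \<open>p(0, v)\<close>, a polynomial in the second block only.\<close>

definition first_block_zero :: "('n + 'n) mpoly \<Rightarrow> 'n mpoly" where
  "first_block_zero = mpoly_subst (case_sum (\<lambda>_. 0) Var)"

end

theory Submission
  imports Defs "HOL-Complex_Analysis.Great_Picard"
    "HOL-Computational_Algebra.Fundamental_Theorem_Algebra"
begin

text \<open>
  All three sums are pairings of Taylor coefficients, and their zero-freeness is Grace's apolarity
  theorem in disguise. Write \<open>f\<^sub>\<alpha>(u, v)\<close> and \<open>g\<^sub>\<beta>(z, w)\<close> for the coefficients of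
  \<open>f(u + s, v)\<close> and \<open>g(z + t, w)\<close> as polynomials in \<open>s\<close> and \<open>t\<close>. Up to the factor \<open>\<kappa>!\<close>, part (b) is
  the sum of \<open>(- 1)\<^sup>\<alpha> f\<^sub>\<alpha> g\<^sub>\<alpha> / (\<kappa> choose \<alpha>)\<close>, part (c) is the same without the sign and at
  \<open>u = z = 0\<close>, and part (a) is the sum of \<open>f\<^sub>\<alpha> g\<^sub>\<beta> / (\<kappa> choose \<alpha>)\<close> over \<open>\<alpha> + \<beta> = \<kappa>\<close>, where the
  binomial coefficients are products over the indices. The variables \<open>v\<close> and \<open>w\<close> are mere parameters.

  The core is a statement about two variables, \<open>grace_bivariate\<close>: if a polynomial with coefficients
  \<open>c a b\<close> of degree at most \<open>k\<close> in \<open>s\<close> and in \<open>t\<close> has no zeros with both variables in \<open>\<Omega>\<close>, then the sum of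
  \<open>\<sigma>\<^sup>a c a a / (k choose a)\<close> is nonzero, for the closed disk with \<open>\<sigma> = 1\<close> and for the closed upper
  half-plane with \<open>\<sigma> = - 1\<close>. It is proved by induction on \<open>k\<close>: Laguerre's theorem on polar derivatives
  (\<open>laguerre\<close>) splits off one new variable from \<open>s\<close> and one from \<open>t\<close>, in which the
  polynomial is affine, and the case of degree one (\<open>contraction\<close>) removes them again. Since the
  polynomial need not be a product \<open>p(s) q(t)\<close>, the indices \<open>i\<close> can be treated one after the other
  (\<open>tensor_nonvanishing\<close>), starting from \<open>f(u + s, v) g(z + t, w)\<close>.

  For part (b) this suffices, since \<open>u + s\<close> stays in the open upper half-plane for \<open>s\<close> in the closed
  one. Part (c) follows by replacing the variables of the first block by \<open>r\<close> times themselves and letting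
  \<open>r\<close> tend to \<open>1\<close>. For part (a), substitute \<open>- 1 / (t + \<eta>)\<close> for \<open>t\<close>: this maps the closed upper
  half-plane into the open one and turns the diagonal pairing into the antidiagonal one as \<open>\<eta>\<close> tends
  to \<open>0\<close>; a rotation reduces the other half-planes to the upper half-plane. The limits are taken with
  Hurwitz's theorem (\<open>stable_limit\<close>), which is where the alternative of an identically vanishing
  polynomial comes from.\<close>

section \<open>Laguerre's theorem on polar derivatives\<close>

text \<open>The logarithmic derivative of \<open>p\<close> at \<open>s\<close> is the sum of \<open>1 / (s - r)\<close> over the roots \<open>r\<close>, so
  divided by the degree it is a convex combination of these numbers. Splitting off one root at a
  time turns this into an induction; \<open>0 \<in> K\<close> is what a constant polynomial needs.\<close>

lemma log_derivative_in_convex: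
  fixes p :: "complex poly" and K :: "complex set"
  assumes "convex K" "0 \<in> K" "poly p s \<noteq> 0"
    and "\<And>r. poly p r = 0 \<Longrightarrow> 1 / (s - r) \<in> K"
  shows "\<exists>x\<in>K. poly (pderiv p) s = of_nat (degree p) * x * poly p s"
  using assms(3,4)
proof (induction "degree p" arbitrary: p)
  case 0
  then have "pderiv p = 0"
    by (simp add: pderiv_eq_0_iff)
  then show ?case
    using \<open>0 \<in> K\<close> by auto
next
  case (Suc d)
  obtain r where r: "poly p r = 0"
    using Suc.hyps(2) Fundamental_Theorem_Algebra.fundamental_theorem_of_algebra[of p]
    by (auto simp: constant_degree)
  then obtain q where p: "p = [:-r, 1:] * q"
    by (auto simp: poly_eq_0_iff_dvd)
  have q0: "q \<noteq> 0" and sr: "s \<noteq> r"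
    using Suc.prems(1) r p by auto
  have "degree p = Suc (degree q)"
    unfolding p by (subst degree_mult_eq) (use q0 in auto)
  then have d: "d = degree q"
    using Suc.hyps(2) by simp
  obtain x where x: "x \<in> K" "poly (pderiv q) s = of_nat (degree q) * x * poly q s"
    using Suc.hyps(1)[OF d] Suc.prems by (force simp: p)
  define y where "y = (1 / of_nat (Suc d)) *\<^sub>R (1 / (s - r)) + (of_nat d / of_nat (Suc d)) *\<^sub>R x"
  have "y \<in> K"
    unfolding y_def
    by (rule convexD[OF \<open>convex K\<close>]) (use Suc.prems(2)[OF r] x in \<open>auto simp: field_simps\<close>)
  moreover have "poly (pderiv p) s = of_nat (degree p) * y * poly p s"
  proof -
    have "of_nat (Suc d) * y = 1 / (s - r) + of_nat d * x"
      by (simp add: y_def scaleR_conv_of_real distrib_left del: of_nat_Suc)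
    moreover have "poly (pderiv p) s = (1 / (s - r) + of_nat d * x) * poly p s"
      unfolding p pderiv_mult poly_add poly_mult x(2) using sr
      by (simp add: pderiv_pCons d field_simps)
    ultimately show ?thesis
      by (simp add: Suc.hyps(2)[symmetric] del: of_nat_Suc)
  qed
  ultimately show ?case by blast
qed

text \<open>What a region must satisfy for Grace's theorem with the pairing
  \<open>(s\<^sup>a, t\<^sup>b) \<mapsto> \<sigma>\<^sup>a / (k choose a)\<close> for \<open>a = b\<close>, and \<open>0\<close> otherwise. The second condition expresses that
  the complement of \<open>\<Omega>\<close>, with infinity added, is convex when seen
  from \<open>s\<close>, that is, after \<open>w \<mapsto> 1 / (s - w)\<close>; the point \<open>x = 0\<close> stands for infinity. The third says that the
  involution \<open>s \<mapsto> - \<sigma> / s\<close>, which exchanges the two roots of a quadratic with product \<open>- \<sigma>\<close>,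
  maps the complement of \<open>\<Omega>\<close> into \<open>\<Omega>\<close>. The two instances below are the closed disk with \<open>\<sigma> = 1\<close>
  and the closed upper half-plane with \<open>\<sigma> = - 1\<close>.\<close>

definition apolar_region :: "complex set \<Rightarrow> complex \<Rightarrow> bool" where
  "apolar_region \<Omega> \<sigma> \<longleftrightarrow> 0 \<in> \<Omega> \<and>
     (\<forall>s\<in>\<Omega>. convex {x. x = 0 \<or> s - 1 / x \<notin> \<Omega>}) \<and>
     (\<forall>s. s \<noteq> 0 \<longrightarrow> s \<in> \<Omega> \<or> - \<sigma> / s \<in> \<Omega>)"

text \<open>The coefficients of the polar derivative \<open>(m + 1) p(s) + (\<zeta> - s) p'(s)\<close> of a polynomial of degree
  at most \<open>m + 1\<close> with coefficients \<open>p\<close>, a polynomial of degree at most \<open>m\<close>. The factor is \<open>m + 1\<close> and not the actual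
  degree of \<open>p\<close>, so that missing roots count as roots at infinity.\<close>

definition polar :: "nat \<Rightarrow> complex \<Rightarrow> (nat \<Rightarrow> complex) \<Rightarrow> nat \<Rightarrow> complex" where
  "polar m \<zeta> p a = of_nat (Suc m - a) * p a + \<zeta> * of_nat (Suc a) * p (Suc a)"

text \<open>Laguerre's theorem. A zero of the polar derivative at \<open>s\<close> would mean that the average \<open>y\<close> of the
  numbers \<open>1 / (s - r)\<close> over all \<open>m + 1\<close> roots equals \<open>1 / (s - \<zeta>)\<close>; but all roots lie outside
  \<open>\<Omega>\<close> and the complement of \<open>\<Omega>\<close> seen from \<open>s\<close> is convex, so \<open>\<zeta>\<close> would lie outside \<open>\<Omega>\<close> as well.\<close>

lemma laguerre:
  assumes \<Omega>: "apolar_region \<Omega> \<sigma>"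
    and nz: "\<And>s. s \<in> \<Omega> \<Longrightarrow> (\<Sum>a\<le>Suc m. p a * s ^ a) \<noteq> 0"
    and s: "s \<in> \<Omega>" and \<zeta>: "\<zeta> \<in> \<Omega>"
  shows "(\<Sum>a\<le>m. polar m \<zeta> p a * s ^ a) \<noteq> 0"
proof
  assume zero: "(\<Sum>a\<le>m. polar m \<zeta> p a * s ^ a) = 0"
  define P where "P = (\<Sum>a\<le>Suc m. monom (p a) a)"
  define K where "K = {x. x = 0 \<or> s - 1 / x \<notin> \<Omega>}"
  have P: "poly P z = (\<Sum>a\<le>Suc m. p a * z ^ a)" for z
    by (simp add: P_def poly_sum poly_monom)
  have deg: "degree P \<le> Suc m"
    unfolding P_def by (rule degree_sum_le) (auto intro: order.trans[OF degree_monom_le])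
  have K: "convex K" "0 \<in> K"
    using \<Omega> s by (auto simp: K_def apolar_region_def)
  have "1 / (s - r) \<in> K" if "poly P r = 0" for r
    using nz[of r] that by (auto simp: P K_def)
  then obtain x where x: "x \<in> K" "poly (pderiv P) s = of_nat (degree P) * x * poly P s"
    using log_derivative_in_convex[OF K] nz[OF s] by (metis P)
  \<comment> \<open>the roots at infinity enter the average with the value \<open>0\<close>\<close>
  define y where "y = (of_nat (degree P) / of_nat (Suc m)) *\<^sub>R x + (1 - of_nat (degree P) / of_nat (Suc m)) *\<^sub>R 0"
  have "y \<in> K"
    unfolding y_def by (rule convexD[OF K(1)]) (use x K deg in \<open>auto simp: divide_le_eq_1 simp del: of_nat_Suc\<close>)
  have y: "poly (pderiv P) s = of_nat (Suc m) * y * poly P s"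
    unfolding x(2) by (simp add: y_def scaleR_conv_of_real del: of_nat_Suc)
  have dP: "poly (pderiv P) s = (\<Sum>a\<le>m. of_nat (Suc a) * p (Suc a) * s ^ a)"
  proof -
    have "poly (pderiv P) s = (\<Sum>a\<le>Suc m. of_nat a * p a * s ^ (a - 1))"
      unfolding P_def sum_comp_morphism[of pderiv, OF pderiv_0 pderiv_add, symmetric]
      by (simp add: poly_sum pderiv_monom poly_monom del: sum.atMost_Suc)
    also have "\<dots> = (\<Sum>a\<le>m. of_nat (Suc a) * p (Suc a) * s ^ a)"
      by (subst sum.atMost_Suc_shift) simp
    finally show ?thesis .
  qed
  have sdP: "s * poly (pderiv P) s = (\<Sum>a\<le>Suc m. of_nat a * p a * s ^ a)"
    unfolding dP by (subst sum.atMost_Suc_shift) (simp add: sum_distrib_left mult_ac)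
  have "of_nat (Suc m) * poly P s - s * poly (pderiv P) s
      = (\<Sum>a\<le>Suc m. of_nat (Suc m - a) * p a * s ^ a)"
    unfolding P sdP sum_distrib_left sum_subtractf[symmetric]
    by (intro sum.cong) (auto simp: of_nat_diff algebra_simps)
  also have "\<dots> = (\<Sum>a\<le>m. of_nat (Suc m - a) * p a * s ^ a)"
    by simp
  moreover have "(\<Sum>a\<le>m. polar m \<zeta> p a * s ^ a)
      = (\<Sum>a\<le>m. of_nat (Suc m - a) * p a * s ^ a) + \<zeta> * poly (pderiv P) s"
    unfolding polar_def dP sum_distrib_left distrib_right sum.distrib by (simp only: mult_ac)
  ultimately have "(\<Sum>a\<le>m. polar m \<zeta> p a * s ^ a)
      = of_nat (Suc m) * poly P s + (\<zeta> - s) * poly (pderiv P) s"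
    by (simp add: algebra_simps)
  then have "of_nat (Suc m) * poly P s * (1 + (\<zeta> - s) * y) = 0"
    using zero by (simp add: y algebra_simps)
  then have "1 + (\<zeta> - s) * y = 0"
    using nz[OF s] by (simp add: P del: of_nat_Suc)
  then have "(s - \<zeta>) * y = 1" by (simp add: algebra_simps)
  moreover from this have "y \<noteq> 0" by auto
  ultimately have "y \<noteq> 0" "s - 1 / y = \<zeta>"
    by (simp_all add: field_simps)
  then show False
    using \<open>y \<in> K\<close> \<zeta> by (auto simp: K_def)
qed

lemma quadratic_root:
  fixes b c :: complex
  shows "\<exists>s. s\<^sup>2 + b * s + c = 0"
proof
  let ?q = "csqrt (b\<^sup>2 - 4 * c)"
  have "((?q - b) / 2)\<^sup>2 + b * ((?q - b) / 2) + c = (?q\<^sup>2 - (b\<^sup>2 - 4 * c)) / 4"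
    by (simp add: power2_eq_square field_simps del: power2_csqrt)
  then show "((?q - b) / 2)\<^sup>2 + b * ((?q - b) / 2) + c = 0"
    by simp
qed

section \<open>Grace's theorem for bivariate polynomials\<close>

text \<open>Grace's theorem in degree one, also known as Asano contraction. On the diagonal \<open>s = t\<close> the
  polynomial is a quadratic; if \<open>a = - \<sigma> d\<close>, its roots have product \<open>- \<sigma>\<close>, hence one of them
  lies in \<open>\<Omega>\<close>.\<close>

lemma contraction:
  assumes \<Omega>: "apolar_region \<Omega> \<sigma>"
    and nz: "\<And>s t. s \<in> \<Omega> \<Longrightarrow> t \<in> \<Omega> \<Longrightarrow> a + b * s + c * t + d * s * t \<noteq> 0"
  shows "a + \<sigma> * d \<noteq> 0"
proof
  assume eq: "a + \<sigma> * d = 0"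
  have "a \<noteq> 0"
    using nz[of 0 0] \<Omega> by (simp add: apolar_region_def)
  then have "d \<noteq> 0" "\<sigma> \<noteq> 0" using eq by auto
  obtain s where "s\<^sup>2 + ((b + c) / d) * s + (- \<sigma>) = 0"
    using quadratic_root by blast
  then have root: "d * s\<^sup>2 + (b + c) * s - d * \<sigma> = 0"
    using \<open>d \<noteq> 0\<close> by (simp add: field_simps)
  then have "s \<noteq> 0" using \<open>d \<noteq> 0\<close> \<open>\<sigma> \<noteq> 0\<close> by auto
  have a: "a = - \<sigma> * d" using eq by (simp add: algebra_simps eq_neg_iff_add_eq_0)
  have "a + b * s + c * s + d * s * s = 0"
    using root by (simp add: a power2_eq_square algebra_simps)
  moreover have "a + b * (- \<sigma> / s) + c * (- \<sigma> / s) + d * (- \<sigma> / s) * (- \<sigma> / s) = 0"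
  proof -
    have "s\<^sup>2 * (a + b * (- \<sigma> / s) + c * (- \<sigma> / s) + d * (- \<sigma> / s) * (- \<sigma> / s))
        = - \<sigma> * (d * s\<^sup>2 + (b + c) * s - d * \<sigma>)"
      using \<open>s \<noteq> 0\<close> by (simp add: a power2_eq_square field_simps)
    then show ?thesis using root \<open>s \<noteq> 0\<close> by simp
  qed
  ultimately show False
    using \<Omega> \<open>s \<noteq> 0\<close> nz unfolding apolar_region_def by blast
qed

text \<open>The two identities that make the weights \<open>1 / (k choose a)\<close> compatible with passing from degree
  \<open>m + 1\<close> to degree \<open>m\<close> in the next lemma.\<close>

lemma binomial_weights:
  assumes "a \<le> m"
  shows "complex_of_nat (Suc m - a) * of_nat (Suc m - a) / of_nat (m choose a)
         = of_nat (Suc m) * of_nat (Suc m - a) / of_nat (Suc m choose a)"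
    and "complex_of_nat (Suc a) * of_nat (Suc a) / of_nat (m choose a)
         = of_nat (Suc m) * of_nat (Suc a) / of_nat (Suc m choose Suc a)"
proof -
  have "(Suc m - a) * (Suc m choose a) = Suc m * (m choose a)"
    using binomial_absorb_comp[of "Suc m" a] by simp
  then have 1: "complex_of_nat (Suc m - a) * of_nat (Suc m choose a) = of_nat (Suc m) * of_nat (m choose a)"
    by (metis of_nat_mult)
  have nz: "complex_of_nat (m choose a) \<noteq> 0" "complex_of_nat (Suc m choose a) \<noteq> 0"
      "complex_of_nat (Suc m choose Suc a) \<noteq> 0"
    using assms by (simp_all del: binomial_Suc_Suc)
  show "complex_of_nat (Suc m - a) * of_nat (Suc m - a) / of_nat (m choose a)
         = of_nat (Suc m) * of_nat (Suc m - a) / of_nat (Suc m choose a)"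
    unfolding frac_eq_eq[OF nz(1,2)] using 1 by (metis mult.assoc mult.commute)
  have 2: "complex_of_nat (Suc a) * of_nat (Suc m choose Suc a) = of_nat (Suc m) * of_nat (m choose a)"
    by (metis of_nat_mult Suc_times_binomial)
  show "complex_of_nat (Suc a) * of_nat (Suc a) / of_nat (m choose a)
         = of_nat (Suc m) * of_nat (Suc a) / of_nat (Suc m choose Suc a)"
    unfolding frac_eq_eq[OF nz(1,3)] using 2 by (metis mult.assoc mult.commute)
qed

text \<open>A form of Grace's apolarity theorem in which the product \<open>p(s) q(t)\<close> is replaced by an arbitrary
  bivariate polynomial; this generality is what allows treating one index after the other in several
  variables. Take a polar derivative in \<open>s\<close> with pole \<open>\<zeta>\<close> and one in \<open>t\<close> with pole \<open>\<xi>\<close>. By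
  Laguerre's theorem the result has no zeros, and it is affine in \<open>\<zeta>\<close> and \<open>\<xi>\<close>. Contracting these
  two variables leaves a zero-free polynomial in \<open>s\<close> and \<open>t\<close> of degree one less in each, whose
  pairing is a nonzero multiple of the given one.\<close>

lemma grace_bivariate:
  fixes c :: "nat \<Rightarrow> nat \<Rightarrow> complex"
  assumes \<Omega>: "apolar_region \<Omega> \<sigma>"
    and nz: "\<And>s t. s \<in> \<Omega> \<Longrightarrow> t \<in> \<Omega> \<Longrightarrow> (\<Sum>a\<le>k. \<Sum>b\<le>k. c a b * s ^ a * t ^ b) \<noteq> 0"
  shows "(\<Sum>a\<le>k. \<sigma> ^ a * c a a / of_nat (k choose a)) \<noteq> 0"
  using nz
proof (induction k arbitrary: c)
  case 0
  then show ?case using \<Omega> by (auto simp: apolar_region_def)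
next
  case (Suc m)
  define c' where "c' a b = of_nat (Suc m - a) * of_nat (Suc m - b) * c a b
      + \<sigma> * of_nat (Suc a) * of_nat (Suc b) * c (Suc a) (Suc b)" for a b
  \<comment> \<open>the polar derivative in \<open>s\<close> alone, still of degree \<open>m + 1\<close> in \<open>t\<close>\<close>
  have step1: "(\<Sum>b\<le>Suc m. (\<Sum>a\<le>m. polar m \<zeta> (\<lambda>a. c a b) a * s ^ a) * t ^ b) \<noteq> 0"
    if "s \<in> \<Omega>" "\<zeta> \<in> \<Omega>" "t \<in> \<Omega>" for s \<zeta> t
  proof -
    have "(\<Sum>a\<le>m. polar m \<zeta> (\<lambda>a. \<Sum>b\<le>Suc m. c a b * t ^ b) a * s ^ a) \<noteq> 0"
    proof (rule laguerre[OF \<Omega> _ that(1,2)])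
      fix s assume "s \<in> \<Omega>"
      from Suc.prems[OF this that(3)] show "(\<Sum>a\<le>Suc m. (\<Sum>b\<le>Suc m. c a b * t ^ b) * s ^ a) \<noteq> 0"
        by (simp add: sum_distrib_left sum_distrib_right mult_ac del: sum.atMost_Suc)
    qed
    also have "(\<Sum>a\<le>m. polar m \<zeta> (\<lambda>a. \<Sum>b\<le>Suc m. c a b * t ^ b) a * s ^ a)
        = (\<Sum>a\<le>m. \<Sum>b\<le>Suc m. polar m \<zeta> (\<lambda>a. c a b) a * s ^ a * t ^ b)"
      unfolding polar_def sum_distrib_left sum_distrib_right sum.distrib distrib_right
      by (simp only: mult_ac)
    also have "\<dots> = (\<Sum>b\<le>Suc m. (\<Sum>a\<le>m. polar m \<zeta> (\<lambda>a. c a b) a * s ^ a) * t ^ b)"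
      by (subst sum.swap) (simp only: sum_distrib_right)
    finally show ?thesis .
  qed
  have "(\<Sum>a\<le>m. \<Sum>b\<le>m. c' a b * s ^ a * t ^ b) \<noteq> 0" if st: "s \<in> \<Omega>" "t \<in> \<Omega>" for s t
  proof -
    define A where "A = (\<Sum>a\<le>m. \<Sum>b\<le>m. of_nat (Suc m - a) * of_nat (Suc m - b) * c a b * s ^ a * t ^ b)"
    define B where "B = (\<Sum>a\<le>m. \<Sum>b\<le>m. of_nat (Suc a) * of_nat (Suc m - b) * c (Suc a) b * s ^ a * t ^ b)"
    define C where "C = (\<Sum>a\<le>m. \<Sum>b\<le>m. of_nat (Suc m - a) * of_nat (Suc b) * c a (Suc b) * s ^ a * t ^ b)"
    define D where "D = (\<Sum>a\<le>m. \<Sum>b\<le>m. of_nat (Suc a) * of_nat (Suc b) * c (Suc a) (Suc b) * s ^ a * t ^ b)"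
    have "A + \<sigma> * D \<noteq> 0"
    proof (rule contraction[OF \<Omega>])
      fix \<zeta> \<xi> assume z: "\<zeta> \<in> \<Omega>" "\<xi> \<in> \<Omega>"
      have "(\<Sum>b\<le>m. polar m \<xi> (\<lambda>b. \<Sum>a\<le>m. polar m \<zeta> (\<lambda>a. c a b) a * s ^ a) b * t ^ b) \<noteq> 0"
        by (rule laguerre[OF \<Omega> _ st(2) z(2)]) (rule step1[OF st(1) z(1)])
      also have "(\<Sum>b\<le>m. polar m \<xi> (\<lambda>b. \<Sum>a\<le>m. polar m \<zeta> (\<lambda>a. c a b) a * s ^ a) b * t ^ b)
          = (\<Sum>b\<le>m. \<Sum>a\<le>m. (of_nat (Suc m - b) * polar m \<zeta> (\<lambda>a. c a b) a
              + \<xi> * of_nat (Suc b) * polar m \<zeta> (\<lambda>a. c a (Suc b)) a) * s ^ a * t ^ b)"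
        unfolding polar_def[of m \<xi>]
        by (simp only: sum_distrib_left sum_distrib_right sum.distrib distrib_right distrib_left mult_ac add_ac)
      also have "\<dots> = (\<Sum>a\<le>m. \<Sum>b\<le>m. (of_nat (Suc m - b) * polar m \<zeta> (\<lambda>a. c a b) a
              + \<xi> * of_nat (Suc b) * polar m \<zeta> (\<lambda>a. c a (Suc b)) a) * s ^ a * t ^ b)"
        by (rule sum.swap)
      also have "\<dots> = A + B * \<zeta> + C * \<xi> + D * \<zeta> * \<xi>"
        unfolding A_def B_def C_def D_def polar_def
        by (simp only: sum_distrib_left sum_distrib_right sum.distrib distrib_right distrib_left mult_ac add_ac)
      finally show "A + B * \<zeta> + C * \<xi> + D * \<zeta> * \<xi> \<noteq> 0" .
    qed
    also have "A + \<sigma> * D = (\<Sum>a\<le>m. \<Sum>b\<le>m. c' a b * s ^ a * t ^ b)"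
      unfolding A_def D_def c'_def sum_distrib_left sum.distrib distrib_right
      by (simp only: mult_ac)
    finally show ?thesis .
  qed
  from Suc.IH[of c', OF this] have "(\<Sum>a\<le>m. \<sigma> ^ a * c' a a / of_nat (m choose a)) \<noteq> 0" .
  also have "(\<Sum>a\<le>m. \<sigma> ^ a * c' a a / of_nat (m choose a))
      = of_nat (Suc m) * of_nat (Suc m) * (\<Sum>a\<le>Suc m. \<sigma> ^ a * c a a / of_nat (Suc m choose a))"
  proof -
    define e where "e a = \<sigma> ^ a * c a a / of_nat (Suc m choose a)" for a
    have "(\<Sum>a\<le>m. \<sigma> ^ a * c' a a / of_nat (m choose a))
        = (\<Sum>a\<le>m. of_nat (Suc m) * (of_nat (Suc m - a) * e a) + of_nat (Suc m) * (of_nat (Suc a) * e (Suc a)))"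
    proof (rule sum.cong)
      fix a assume "a \<in> {..m}"
      then have "a \<le> m" by simp
      note w = binomial_weights[OF this]
      have "\<sigma> ^ a * c' a a / of_nat (m choose a)
          = \<sigma> ^ a * c a a * (of_nat (Suc m - a) * of_nat (Suc m - a) / of_nat (m choose a))
          + \<sigma> ^ Suc a * c (Suc a) (Suc a) * (of_nat (Suc a) * of_nat (Suc a) / of_nat (m choose a))"
        by (simp add: c'_def distrib_left add_divide_distrib mult_ac del: of_nat_Suc of_nat_diff)
      also have "\<dots> = of_nat (Suc m) * (of_nat (Suc m - a) * e a) + of_nat (Suc m) * (of_nat (Suc a) * e (Suc a))"
        unfolding w e_def by (simp add: mult_ac del: of_nat_Suc binomial_Suc_Suc)
      finally show "\<sigma> ^ a * c' a a / of_nat (m choose a) = \<dots>" .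
    qed simp
    also have "\<dots> = of_nat (Suc m) * ((\<Sum>a\<le>m. of_nat (Suc m - a) * e a) + (\<Sum>a\<le>m. of_nat (Suc a) * e (Suc a)))"
      by (simp add: sum.distrib sum_distrib_left distrib_left del: of_nat_Suc)
    also have "(\<Sum>a\<le>m. of_nat (Suc m - a) * e a) = (\<Sum>a\<le>Suc m. of_nat (Suc m - a) * e a)"
      by simp
    also have "(\<Sum>a\<le>m. of_nat (Suc a) * e (Suc a)) = (\<Sum>a\<le>Suc m. of_nat a * e a)"
      by (subst sum.atMost_Suc_shift) simp
    also have "(\<Sum>a\<le>Suc m. of_nat (Suc m - a) * e a) + (\<Sum>a\<le>Suc m. of_nat a * e a)
        = of_nat (Suc m) * (\<Sum>a\<le>Suc m. e a)"
      unfolding sum.distrib[symmetric] sum_distrib_left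
      by (intro sum.cong) (auto simp: of_nat_diff algebra_simps)
    finally show ?thesis by (simp add: e_def mult.assoc del: of_nat_Suc sum.atMost_Suc)
  qed
  finally show ?case by auto
qed

section \<open>The disk and the half-plane as apolar regions\<close>

text \<open>The complements of the disk and of the half-plane, seen from a point \<open>s\<close>, are sublevel sets of
  functions \<open>x \<mapsto> A \<bar>x\<bar>\<^sup>2 + Re (l x)\<close> with \<open>A \<ge> 0\<close>; their convexity rests on this inequality.\<close>

lemma quadratic_form_convex:
  fixes l x y :: complex and A \<mu> \<nu> :: real
  assumes "A \<ge> 0" "\<mu> \<ge> 0" "\<nu> \<ge> 0" "\<mu> + \<nu> = 1"
  shows "A * (norm (\<mu> *\<^sub>R x + \<nu> *\<^sub>R y))\<^sup>2 + Re (l * (\<mu> *\<^sub>R x + \<nu> *\<^sub>R y))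
    \<le> \<mu> * (A * (norm x)\<^sup>2 + Re (l * x)) + \<nu> * (A * (norm y)\<^sup>2 + Re (l * y))"
proof -
  have \<mu>: "\<mu> = 1 - \<nu>" using assms by simp
  have "\<mu> * (norm x)\<^sup>2 + \<nu> * (norm y)\<^sup>2 - (norm (\<mu> *\<^sub>R x + \<nu> *\<^sub>R y))\<^sup>2 = \<mu> * \<nu> * (norm (x - y))\<^sup>2"
    unfolding cmod_power2 \<mu> by (simp add: power2_eq_square algebra_simps)
  then have "(norm (\<mu> *\<^sub>R x + \<nu> *\<^sub>R y))\<^sup>2 \<le> \<mu> * (norm x)\<^sup>2 + \<nu> * (norm y)\<^sup>2"
    using assms by (metis diff_ge_0_iff_ge mult_nonneg_nonneg zero_le_power2)
  then have "A * (norm (\<mu> *\<^sub>R x + \<nu> *\<^sub>R y))\<^sup>2 \<le> A * (\<mu> * (norm x)\<^sup>2 + \<nu> * (norm y)\<^sup>2)"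
    using assms(1) by (rule mult_left_mono)
  then show ?thesis by (simp add: algebra_simps)
qed

lemma apolar_region_disc: "apolar_region (cball 0 1) 1"
  unfolding apolar_region_def
proof (intro conjI ballI allI impI)
  fix s :: complex assume s: "s \<in> cball 0 1"
  have eq: "x = 0 \<or> s - 1 / x \<notin> cball 0 1 \<longleftrightarrow>
      (1 - (norm s)\<^sup>2) * (norm x)\<^sup>2 + Re (2 * s * x) < 1" for x
  proof (cases "x = 0")
    case False
    have "s - 1 / x = (s * x - 1) / x" using False by (simp add: field_simps)
    then have "s - 1 / x \<notin> cball 0 1 \<longleftrightarrow> norm x < norm (s * x - 1)"
      using False by (auto simp: norm_divide field_simps)
    also have "\<dots> \<longleftrightarrow> (norm x)\<^sup>2 < (norm (s * x - 1))\<^sup>2"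
      by (meson norm_ge_zero not_le power2_le_imp_le power_mono)
    also have "(norm (s * x - 1))\<^sup>2 = (norm s)\<^sup>2 * (norm x)\<^sup>2 - Re (2 * s * x) + 1"
      unfolding cmod_power2 by (simp add: power2_eq_square algebra_simps)
    finally show ?thesis using False by (simp add: algebra_simps)
  qed simp
  have A: "1 - (norm s)\<^sup>2 \<ge> 0" using s by (simp add: power_le_one)
  show "convex {x. x = 0 \<or> s - 1 / x \<notin> cball 0 1}"
    unfolding eq
    by (intro convexI CollectI le_less_trans[OF quadratic_form_convex[OF A]] convex_bound_lt)
      (simp_all only: mem_Collect_eq)
qed (auto simp: norm_divide field_simps)

lemma apolar_region_half_plane: "apolar_region {z. Im z \<ge> 0} (- 1)"
  unfolding apolar_region_def
proof (intro conjI ballI allI impI)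
  fix s :: complex assume s: "s \<in> {z. Im z \<ge> 0}"
  define q where "q x = Im s * (norm x)\<^sup>2 + Re (- \<i> * x)" for x
  have eq: "x = 0 \<or> s - 1 / x \<notin> {z. Im z \<ge> 0} \<longleftrightarrow> x = 0 \<or> q x < 0" for x
  proof (cases "x = 0")
    case False
    then have "(norm x)\<^sup>2 > 0" by simp
    moreover have "Im (1 / x) = - Im x / (norm x)\<^sup>2"
      by (simp add: Im_divide flip: cmod_power2)
    then have "Im (s - 1 / x) = q x / (norm x)\<^sup>2"
      using False by (simp add: q_def add_divide_distrib)
    ultimately show ?thesis using False
      by (simp add: not_le divide_less_0_iff)
  qed simp
  show "convex {x. x = 0 \<or> s - 1 / x \<notin> {z. Im z \<ge> 0}}"
    unfolding eq
  \<comment> \<open>the region is an open disk or half-plane together with its boundary point \<open>0\<close>\<close>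
  proof (rule convexI)
    fix x y :: complex and \<mu> \<nu> :: real
    assume x: "x \<in> {x. x = 0 \<or> q x < 0}" and y: "y \<in> {x. x = 0 \<or> q x < 0}"
      and w: "\<mu> \<ge> 0" "\<nu> \<ge> 0" "\<mu> + \<nu> = 1"
    have le: "q (\<mu> *\<^sub>R x + \<nu> *\<^sub>R y) \<le> \<mu> * q x + \<nu> * q y"
      unfolding q_def by (rule quadratic_form_convex) (use s w in auto)
    have q0: "q 0 = 0" by (simp add: q_def)
    have "\<mu> * q x \<le> 0" "\<nu> * q y \<le> 0"
      using x y w q0 by (auto simp: mult_nonneg_nonpos)
    moreover have "\<mu> * q x < 0" if "\<mu> *\<^sub>R x \<noteq> 0"
      using that x w by (auto simp: mult_pos_neg)
    moreover have "\<nu> * q y < 0" if "\<nu> *\<^sub>R y \<noteq> 0"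
      using that y w by (auto simp: mult_pos_neg)
    ultimately show "\<mu> *\<^sub>R x + \<nu> *\<^sub>R y \<in> {x. x = 0 \<or> q x < 0}"
      using le by (cases "\<mu> *\<^sub>R x = 0"; cases "\<nu> *\<^sub>R y = 0") auto
  qed
next
  fix s :: complex assume "s \<noteq> 0"
  have "Im (1 / s) = - Im s / (norm s)\<^sup>2"
    by (simp add: Im_divide flip: cmod_power2)
  then have "Im (1 / s) \<ge> 0" if "Im s < 0"
    using that by (simp add: divide_nonpos_nonneg)
  then show "s \<in> {z. Im z \<ge> 0} \<or> - (- 1) / s \<in> {z. Im z \<ge> 0}"
    by (cases "Im s < 0") auto
qed auto

section \<open>Polynomials as functions\<close>

lemma poly_mapping_eq_sum_single:
  "p = (\<Sum>m\<in>Poly_Mapping.keys p. Poly_Mapping.single m (Poly_Mapping.lookup p m))"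
  by (rule poly_mapping_eqI) (simp add: lookup_sum lookup_single when_def in_keys_iff)

lemma mpoly_eval_eq_sum:
  fixes x :: "'x::finite \<Rightarrow> complex"
  assumes "finite S" "Poly_Mapping.keys p \<subseteq> S"
  shows "mpoly_eval x p = (\<Sum>m\<in>S. Poly_Mapping.lookup p m * (\<Prod>i\<in>UNIV. x i ^ Poly_Mapping.lookup m i))"
proof -
  have prod: "(\<Prod>i\<in>Poly_Mapping.keys m. x i ^ Poly_Mapping.lookup m i) = (\<Prod>i\<in>UNIV. x i ^ Poly_Mapping.lookup m i)" for m
    by (rule prod.mono_neutral_left) (auto simp: in_keys_iff)
  show ?thesis
    unfolding mpoly_eval_def prod
    by (rule sum.mono_neutral_left) (use assms in \<open>auto simp: in_keys_iff\<close>)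
qed

lemma mpoly_eval_zero [simp]: "mpoly_eval x 0 = 0"
  by (simp add: mpoly_eval_def)

lemma mpoly_eval_add:
  fixes x :: "'x::finite \<Rightarrow> complex"
  shows "mpoly_eval x (p + q) = mpoly_eval x p + mpoly_eval x q"
proof -
  let ?S = "Poly_Mapping.keys p \<union> Poly_Mapping.keys q"
  have "Poly_Mapping.keys (p + q) \<subseteq> ?S" by (rule keys_add)
  then show ?thesis
    by (simp add: mpoly_eval_eq_sum[of ?S] lookup_add distrib_right sum.distrib)
qed

lemma mpoly_eval_sum:
  fixes x :: "'x::finite \<Rightarrow> complex"
  shows "mpoly_eval x (\<Sum>j\<in>J. p j) = (\<Sum>j\<in>J. mpoly_eval x (p j))"
  by (induction J rule: infinite_finite_induct) (simp_all add: mpoly_eval_add)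

lemma mpoly_eval_single:
  fixes x :: "'x::finite \<Rightarrow> complex"
  shows "mpoly_eval x (Poly_Mapping.single m c) = c * (\<Prod>i\<in>UNIV. x i ^ Poly_Mapping.lookup m i)"
  by (subst mpoly_eval_eq_sum[of "{m}"]) auto

lemma mpoly_eval_mult:
  fixes x :: "'x::finite \<Rightarrow> complex"
  shows "mpoly_eval x (p * q) = mpoly_eval x p * mpoly_eval x q"
proof -
  have "p * q = (\<Sum>m\<in>Poly_Mapping.keys p. Poly_Mapping.single m (Poly_Mapping.lookup p m))
      * (\<Sum>l\<in>Poly_Mapping.keys q. Poly_Mapping.single l (Poly_Mapping.lookup q l))"
    by (simp flip: poly_mapping_eq_sum_single)
  also have "\<dots> = (\<Sum>m\<in>Poly_Mapping.keys p. \<Sum>l\<in>Poly_Mapping.keys q.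
      Poly_Mapping.single (m + l) (Poly_Mapping.lookup p m * Poly_Mapping.lookup q l))"
    by (simp add: sum_product mult_single)
  finally have "mpoly_eval x (p * q) = (\<Sum>m\<in>Poly_Mapping.keys p. \<Sum>l\<in>Poly_Mapping.keys q. mpoly_eval x
      (Poly_Mapping.single (m + l) (Poly_Mapping.lookup p m * Poly_Mapping.lookup q l)))"
    by (simp add: mpoly_eval_sum)
  also have "\<dots> = mpoly_eval x p * mpoly_eval x q"
    by (simp add: mpoly_eval_single mpoly_eval_eq_sum[OF finite_keys order_refl, where p = p]
        mpoly_eval_eq_sum[OF finite_keys order_refl, where p = q]
        sum_product lookup_add power_add prod.distrib mult_ac)
  finally show ?thesis .
qed

lemma mpoly_eval_Const [simp]: "mpoly_eval x (Const c) = c"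
  by (simp add: mpoly_eval_def Const_def)

lemma mpoly_eval_Var [simp]: "mpoly_eval x (Var i) = x i"
  by (simp add: mpoly_eval_def Var_def)

lemma mpoly_eval_power:
  fixes x :: "'x::finite \<Rightarrow> complex"
  shows "mpoly_eval x (p ^ k) = mpoly_eval x p ^ k"
  by (induction k) (simp_all add: mpoly_eval_mult mpoly_eval_Const[of x 1, unfolded Const_def, simplified])

lemma mpoly_eval_prod:
  fixes x :: "'x::finite \<Rightarrow> complex"
  shows "mpoly_eval x (\<Prod>j\<in>J. p j) = (\<Prod>j\<in>J. mpoly_eval x (p j))"
  by (induction J rule: infinite_finite_induct)
    (simp_all add: mpoly_eval_mult mpoly_eval_Const[of x 1, unfolded Const_def, simplified])

lemma mpoly_eval_subst:
  fixes x :: "'y::finite \<Rightarrow> complex"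
  shows "mpoly_eval x (mpoly_subst s p) = mpoly_eval (\<lambda>i. mpoly_eval x (s i)) p"
  unfolding mpoly_subst_def mpoly_eval_sum mpoly_eval_mult mpoly_eval_prod mpoly_eval_power mpoly_eval_Const
  by (simp add: mpoly_eval_def)

lemma mpoly_eval_rename_vars:
  fixes x :: "'y::finite \<Rightarrow> complex"
  shows "mpoly_eval x (rename_vars h p) = mpoly_eval (\<lambda>i. x (h i)) p"
  by (simp add: rename_vars_def mpoly_eval_subst)

lemma mpoly_eval_first_block_zero:
  fixes x :: "'n::finite \<Rightarrow> complex"
  shows "mpoly_eval x (first_block_zero p) = mpoly_eval (case_sum (\<lambda>_. 0) x) p"
proof -
  have "(\<lambda>i :: 'n + 'n. mpoly_eval x (case_sum (\<lambda>_. 0) Var i)) = case_sum (\<lambda>_. 0) x"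
    by (auto simp: fun_eq_iff split: sum.split)
  then show ?thesis
    by (simp add: first_block_zero_def mpoly_eval_subst)
qed

text \<open>Monomials are distinct multiplicative characters of \<open>\<complex>\<^sup>n\<close>, so this is Dedekind's independence of
  characters: comparing the relation at \<open>x y\<close> with \<open>X\<^bsub>m0\<^esub>(y)\<close> times the relation at \<open>x\<close> eliminates
  the character \<open>X\<^bsub>m0\<^esub>\<close>.\<close>

lemma monomials_independent:
  fixes c :: "('x::finite \<Rightarrow>\<^sub>0 nat) \<Rightarrow> complex"
  assumes "finite S" "\<And>x. (\<Sum>m\<in>S. c m * (\<Prod>i\<in>UNIV. x i ^ Poly_Mapping.lookup m i)) = 0" "m \<in> S"
  shows "c m = 0"
  using assms
proof (induction S arbitrary: c m rule: finite_induct)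
  case (insert m0 S)
  define X where "X m x = (\<Prod>i\<in>UNIV. x i ^ Poly_Mapping.lookup m i)" for m :: "'x \<Rightarrow>\<^sub>0 nat" and x :: "'x \<Rightarrow> complex"
  have X_mult: "X m (\<lambda>i. x i * y i) = X m x * X m y" for m x y
    by (simp add: X_def power_mult_distrib prod.distrib)
  have zero: "c m0 * X m0 x + (\<Sum>m\<in>S. c m * X m x) = 0" for x
    using insert.prems(1)[of x] insert.hyps by (simp add: X_def)
  have S: "c m = 0" if m: "m \<in> S" for m
  proof -
    obtain i where i: "Poly_Mapping.lookup m i \<noteq> Poly_Mapping.lookup m0 i"
      using m insert.hyps by (metis poly_mapping_eqI)
    define y where "y = (\<lambda>j. if j = i then 2 else 1 :: complex)"
    have y: "X m y = 2 ^ Poly_Mapping.lookup m i" for m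
    proof -
      have "X m y = (\<Prod>j\<in>UNIV. if j = i then 2 ^ Poly_Mapping.lookup m i else 1)"
        unfolding X_def y_def by (rule prod.cong) auto
      then show ?thesis by simp
    qed
    have "(\<Sum>m\<in>S. (c m * (X m y - X m0 y)) * (\<Prod>i\<in>UNIV. x i ^ Poly_Mapping.lookup m i)) = 0" for x
    proof -
      have "(\<Sum>m\<in>S. (c m * (X m y - X m0 y)) * X m x)
          = (c m0 * X m0 (\<lambda>i. x i * y i) + (\<Sum>m\<in>S. c m * X m (\<lambda>i. x i * y i)))
            - X m0 y * (c m0 * X m0 x + (\<Sum>m\<in>S. c m * X m x))"
        by (simp add: X_mult algebra_simps sum_distrib_left sum_subtractf)
      then show ?thesis unfolding zero by (simp add: X_def)
    qed
    from insert.IH[OF this m] have "c m = 0 \<or> (2::complex) ^ Poly_Mapping.lookup m i = 2 ^ Poly_Mapping.lookup m0 i"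
      by (simp add: y)
    moreover have "(2::complex) ^ Poly_Mapping.lookup m i \<noteq> 2 ^ Poly_Mapping.lookup m0 i"
    proof
      assume "(2::complex) ^ Poly_Mapping.lookup m i = 2 ^ Poly_Mapping.lookup m0 i"
      then have "norm ((2::complex) ^ Poly_Mapping.lookup m i) = norm ((2::complex) ^ Poly_Mapping.lookup m0 i)" by simp
      then show False using i by (simp add: norm_power)
    qed
    ultimately show ?thesis by simp
  qed
  moreover have "c m0 = 0"
    using zero[of "\<lambda>_. 1"] S by (simp add: X_def)
  ultimately show ?case using insert.prems(2) by auto
qed simp

lemma mpoly_eval_nonzero_somewhere:
  fixes p :: "'x::finite mpoly"
  assumes "p \<noteq> 0"
  shows "\<exists>x. mpoly_eval x p \<noteq> 0"
proof (rule ccontr)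
  assume "\<nexists>x. mpoly_eval x p \<noteq> 0"
  then have "Poly_Mapping.lookup p m = 0" if "m \<in> Poly_Mapping.keys p" for m
    using monomials_independent[OF finite_keys _ that, of "Poly_Mapping.lookup p"]
    by (simp add: mpoly_eval_eq_sum[OF finite_keys order_refl])
  then show False using assms by (auto simp: in_keys_iff poly_mapping_eq_iff fun_eq_iff)
qed

section \<open>Partial derivatives and the Taylor expansion\<close>

lemma mpoly_pderiv_add: "mpoly_pderiv i (p + q) = mpoly_pderiv i p + mpoly_pderiv i q"
  by (rule poly_mapping_eqI) (simp add: lookup_mpoly_pderiv lookup_add distrib_left)

lemma mpoly_pderiv_zero [simp]: "mpoly_pderiv i 0 = 0"
  by (simp add: mpoly_pderiv_def)

lemma mpoly_pderiv_single:
  "mpoly_pderiv i (Poly_Mapping.single m c) =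
   Poly_Mapping.single (m - Poly_Mapping.single i 1) (c * of_nat (Poly_Mapping.lookup m i))"
  by (cases "c = 0") (simp_all add: mpoly_pderiv_def mult.commute)

lemma falling_factorial_step:
  "(n - a) * (fact a * (n choose a)) = fact (Suc a) * (n choose Suc a)"
proof (cases n)
  case (Suc k)
  then show ?thesis
    using binomial_absorb_comp[of n a] Suc_times_binomial[of a k]
    by (metis diff_Suc_1 fact_Suc mult.assoc mult.commute of_nat_id)
qed simp

lemma mpoly_pderiv_funpow_single:
  "(mpoly_pderiv i ^^ a) (Poly_Mapping.single m c) =
   Poly_Mapping.single (m - Poly_Mapping.single i a)
     (c * of_nat (fact a * (Poly_Mapping.lookup m i choose a)))"
proof (induction a)
  case (Suc a)
  have "(mpoly_pderiv i ^^ Suc a) (Poly_Mapping.single m c)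
      = Poly_Mapping.single (m - Poly_Mapping.single i a - Poly_Mapping.single i 1)
     (c * of_nat ((Poly_Mapping.lookup m i - a) * (fact a * (Poly_Mapping.lookup m i choose a))))"
    by (simp add: Suc mpoly_pderiv_single lookup_minus mult_ac del: of_nat_diff)
  also have "m - Poly_Mapping.single i a - Poly_Mapping.single i 1 = m - Poly_Mapping.single i (Suc a)"
    by (simp add: diff_diff_add flip: single_add)
  finally show ?case unfolding falling_factorial_step .
qed simp

lemma mpoly_diff_fold_insert:
  assumes "finite I" "j \<notin> I"
  shows "Finite_Set.fold (\<lambda>i. mpoly_pderiv (s i) ^^ \<alpha> i) p (insert j I)
    = (mpoly_pderiv (s j) ^^ \<alpha> j) (Finite_Set.fold (\<lambda>i. mpoly_pderiv (s i) ^^ \<alpha> i) p I)"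
proof -
  interpret comp_fun_commute "\<lambda>i. mpoly_pderiv (s i) ^^ \<alpha> i"
    by (rule comp_fun_commute_mpoly_pderiv_funpow)
  show ?thesis using assms by simp
qed

lemma mpoly_diff_sum:
  fixes s :: "'n::finite \<Rightarrow> 'x"
  shows "mpoly_diff s \<alpha> (\<Sum>j\<in>J. p j) = (\<Sum>j\<in>J. mpoly_diff s \<alpha> (p j))"
proof -
  have pow0: "(mpoly_pderiv i ^^ a) 0 = 0" for i :: 'x and a
    by (induction a) simp_all
  have pow: "(mpoly_pderiv i ^^ a) (p + q) = (mpoly_pderiv i ^^ a) p + (mpoly_pderiv i ^^ a) q" for i :: 'x and a p q
    by (induction a) (simp_all add: mpoly_pderiv_add)
  have "mpoly_diff s \<alpha> 0 = 0"
    unfolding mpoly_diff_def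
    by (rule finite_induct[OF finite]) (simp_all add: mpoly_diff_fold_insert pow0)
  moreover have "mpoly_diff s \<alpha> (p + q) = mpoly_diff s \<alpha> p + mpoly_diff s \<alpha> q" for p q
    unfolding mpoly_diff_def
    by (rule finite_induct[OF finite]) (simp_all add: mpoly_diff_fold_insert pow)
  ultimately show ?thesis
    by (induction J rule: infinite_finite_induct) simp_all
qed

lemma mpoly_diff_single:
  fixes s :: "'n::finite \<Rightarrow> 'x"
  assumes "inj s"
  shows "mpoly_diff s \<alpha> (Poly_Mapping.single m c) =
    Poly_Mapping.single (m - (\<Sum>i\<in>UNIV. Poly_Mapping.single (s i) (\<alpha> i)))
     (c * (\<Prod>i\<in>UNIV. of_nat (fact (\<alpha> i) * (Poly_Mapping.lookup m (s i) choose \<alpha> i))))"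
proof -
  have "Finite_Set.fold (\<lambda>i. mpoly_pderiv (s i) ^^ \<alpha> i) (Poly_Mapping.single m c) I =
    Poly_Mapping.single (m - (\<Sum>i\<in>I. Poly_Mapping.single (s i) (\<alpha> i)))
     (c * (\<Prod>i\<in>I. of_nat (fact (\<alpha> i) * (Poly_Mapping.lookup m (s i) choose \<alpha> i))))"
    if "finite I" for I
    using that
  proof (induction I rule: finite_induct)
    case (insert j I)
    have "(\<Sum>i\<in>I. Poly_Mapping.lookup (Poly_Mapping.single (s i) (\<alpha> i)) (s j)) = 0"
      using insert.hyps injD[OF assms] by (intro sum.neutral) (auto simp: lookup_single when_def)
    then show ?case
      using insert by (simp add: mpoly_diff_fold_insert mpoly_pderiv_funpow_single lookup_minus
          lookup_sum diff_diff_add add.commute mult_ac)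
  qed simp
  then show ?thesis by (simp add: mpoly_diff_def)
qed

lemma prod_UNIV_Plus:
  fixes h :: "'a::finite + 'b::finite \<Rightarrow> complex"
  shows "(\<Prod>i\<in>UNIV. h i) = (\<Prod>i\<in>UNIV. h (Inl i)) * (\<Prod>i\<in>UNIV. h (Inr i))"
  by (subst UNIV_Plus_UNIV[symmetric], subst prod.Plus) (auto simp: comp_def)

lemma mpoly_eval_diff:
  fixes x :: "'n::finite + 'n \<Rightarrow> complex"
  shows "mpoly_eval x (mpoly_diff Inl \<alpha> p) = (\<Sum>m\<in>Poly_Mapping.keys p. Poly_Mapping.lookup p m *
    (\<Prod>i\<in>UNIV. fact (\<alpha> i) * of_nat (Poly_Mapping.lookup m (Inl i) choose \<alpha> i) * x (Inl i) ^ (Poly_Mapping.lookup m (Inl i) - \<alpha> i)) *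
    (\<Prod>i\<in>UNIV. x (Inr i) ^ Poly_Mapping.lookup m (Inr i)))"
proof -
  have L: "Poly_Mapping.lookup (\<Sum>i\<in>UNIV. Poly_Mapping.single (Inl i) (\<alpha> i)) (Inl j) = \<alpha> j" for j :: 'n
    by (simp add: lookup_sum lookup_single when_def)
  have R: "Poly_Mapping.lookup (\<Sum>i\<in>UNIV. Poly_Mapping.single (Inl i) (\<alpha> i)) (Inr j) = 0" for j :: 'n
    by (simp add: lookup_sum lookup_single when_def)
  have "mpoly_eval x (mpoly_diff Inl \<alpha> p) = (\<Sum>m\<in>Poly_Mapping.keys p.
      mpoly_eval x (mpoly_diff Inl \<alpha> (Poly_Mapping.single m (Poly_Mapping.lookup p m))))"
    by (subst poly_mapping_eq_sum_single[of p]) (simp add: mpoly_diff_sum mpoly_eval_sum)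
  then show ?thesis
    by (simp add: mpoly_diff_single mpoly_eval_single prod_UNIV_Plus lookup_minus L R prod.distrib mult_ac)
qed

lemma degree_in_bound:
  assumes "degree_in i p \<le> k" "m \<in> Poly_Mapping.keys p"
  shows "Poly_Mapping.lookup m i \<le> k"
  using assms by (auto simp: degree_in_def)

lemma sum_multi_index_eq_PiE: "{..\<kappa> :: 'n::finite \<Rightarrow> nat} = PiE UNIV (\<lambda>i. {..\<kappa> i})"
  by (auto simp: le_fun_def PiE_def Pi_def)

text \<open>By linearity it is enough to expand a monomial, where the formula is the product over all \<open>i\<close> of
  the binomial theorem for \<open>(u i + s i)\<close>. The sum over multi-indices becomes this product of sums.\<close>

lemma taylor:
  fixes u v s :: "'n::finite \<Rightarrow> complex"
  assumes "\<And>i. degree_in (Inl i) p \<le> \<kappa> i"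
  shows "mpoly_eval (case_sum (\<lambda>i. u i + s i) v) p =
    (\<Sum>\<alpha>\<in>{..\<kappa>}. mpoly_eval (case_sum u v) (mpoly_diff Inl \<alpha> p) / multi_fact \<alpha> * (\<Prod>i\<in>UNIV. s i ^ \<alpha> i))"
proof -
  have bin: "(\<Sum>a\<le>\<kappa> i. of_nat (n choose a) * u i ^ (n - a) * s i ^ a) = (u i + s i) ^ n" if "n \<le> \<kappa> i" for i n
  proof -
    have "(u i + s i) ^ n = (\<Sum>a\<le>n. of_nat (n choose a) * u i ^ (n - a) * s i ^ a)"
      by (subst add.commute) (simp add: binomial_ring mult_ac)
    also have "\<dots> = (\<Sum>a\<le>\<kappa> i. of_nat (n choose a) * u i ^ (n - a) * s i ^ a)"
      by (rule sum.mono_neutral_left) (use that in auto)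
    finally show ?thesis ..
  qed
  define V where "V m = Poly_Mapping.lookup p m * (\<Prod>i\<in>UNIV. v i ^ Poly_Mapping.lookup m (Inr i))" for m
  have "mpoly_eval (case_sum u v) (mpoly_diff Inl \<alpha> p) / multi_fact \<alpha> * (\<Prod>i\<in>UNIV. s i ^ \<alpha> i)
      = (\<Sum>m\<in>Poly_Mapping.keys p. V m *
        (\<Prod>i\<in>UNIV. of_nat (Poly_Mapping.lookup m (Inl i) choose \<alpha> i) * u i ^ (Poly_Mapping.lookup m (Inl i) - \<alpha> i) * s i ^ \<alpha> i))" for \<alpha>
    unfolding mpoly_eval_diff V_def multi_fact_def sum_divide_distrib sum_distrib_right
    by (rule sum.cong) (simp_all add: prod.distrib mult_ac)
  then have "(\<Sum>\<alpha>\<in>{..\<kappa>}. mpoly_eval (case_sum u v) (mpoly_diff Inl \<alpha> p) / multi_fact \<alpha> * (\<Prod>i\<in>UNIV. s i ^ \<alpha> i))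
      = (\<Sum>m\<in>Poly_Mapping.keys p. V m * (\<Sum>\<alpha>\<in>PiE UNIV (\<lambda>i. {..\<kappa> i}).
        (\<Prod>i\<in>UNIV. of_nat (Poly_Mapping.lookup m (Inl i) choose \<alpha> i) * u i ^ (Poly_Mapping.lookup m (Inl i) - \<alpha> i) * s i ^ \<alpha> i)))"
    by (simp add: sum_multi_index_eq_PiE sum_distrib_left sum.swap[of _ _ "Poly_Mapping.keys p"])
  also have "\<dots> = (\<Sum>m\<in>Poly_Mapping.keys p. V m * (\<Prod>i\<in>UNIV. (u i + s i) ^ Poly_Mapping.lookup m (Inl i)))"
    by (intro sum.cong refl, subst prod_sum_PiE[symmetric])
      (auto simp: bin degree_in_bound[OF assms])
  also have "\<dots> = mpoly_eval (case_sum (\<lambda>i. u i + s i) v) p"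
    by (simp add: mpoly_eval_eq_sum[OF finite_keys order_refl] prod_UNIV_Plus V_def mult_ac)
  finally show ?thesis ..
qed

section \<open>Limits of stable polynomials\<close>

lemma holomorphic_on_mpoly_eval_line:
  fixes x y :: "'x::finite \<Rightarrow> complex"
  shows "(\<lambda>\<zeta>. mpoly_eval (\<lambda>i. x i + \<zeta> * y i) p) holomorphic_on S"
  unfolding mpoly_eval_def by (intro holomorphic_intros)

lemma uniform_limit_sum:
  fixes f :: "'j \<Rightarrow> 'a \<Rightarrow> 'b \<Rightarrow> 'c::real_normed_vector"
  assumes "\<And>j. j \<in> J \<Longrightarrow> uniform_limit K (f j) (g j) F"
  shows "uniform_limit K (\<lambda>n x. \<Sum>j\<in>J. f j n x) (\<lambda>x. \<Sum>j\<in>J. g j x) F"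
  using assms
  by (induction J rule: infinite_finite_induct) (auto intro!: uniform_limit_intros)

text \<open>Hurwitz's theorem in several variables. A zero \<open>x\<close> of a nonzero limit is joined by a complex line to
  a point \<open>y\<close> where the limit does not vanish. Along this line and near \<open>x\<close>, the approximating functions
  have no zeros, and the limit is not constant, as it would otherwise vanish on the whole line by
  analytic continuation. So the one-variable theorem applies. The approximations are combinations of
  fixed polynomials with converging coefficients, which gives uniform convergence on compact sets.\<close>

lemma stable_limit:
  fixes P :: "'x::finite mpoly" and p :: "'j \<Rightarrow> 'x mpoly" and \<phi> :: "nat \<Rightarrow> 'j \<Rightarrow> complex"
  assumes \<Omega>: "open \<Omega>"
    and P: "\<And>x. mpoly_eval x P = (\<Sum>j\<in>J. \<phi>\<^sub>0 j * mpoly_eval x (p j))"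
    and lim: "\<And>j. j \<in> J \<Longrightarrow> (\<lambda>n. \<phi> n j) \<longlonglongrightarrow> \<phi>\<^sub>0 j"
    and nz: "\<And>n x. (\<And>i. x i \<in> \<Omega>) \<Longrightarrow> (\<Sum>j\<in>J. \<phi> n j * mpoly_eval x (p j)) \<noteq> 0"
  shows "stable \<Omega> P \<or> P = 0"
proof (cases "P = 0")
  case False
  then obtain y where y: "mpoly_eval y P \<noteq> 0"
    using mpoly_eval_nonzero_somewhere by blast
  have "mpoly_eval x P \<noteq> 0" if x: "\<And>i. x i \<in> \<Omega>" for x
  proof
    assume 0: "mpoly_eval x P = 0"
    define L where "L \<zeta> = (\<lambda>i. x i + \<zeta> * (y i - x i))" for \<zeta>
    have L: "L 0 = x" "L 1 = y" by (simp_all add: L_def)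
    have hol: "(\<lambda>\<zeta>. mpoly_eval (L \<zeta>) q) holomorphic_on S" for q S
      unfolding L_def by (rule holomorphic_on_mpoly_eval_line)
    have "\<forall>\<^sub>F \<zeta> in nhds 0. L \<zeta> i \<in> \<Omega>" for i
    proof -
      have "open ((\<lambda>\<zeta>. L \<zeta> i) -` \<Omega>)"
        unfolding L_def by (rule open_vimage[OF \<Omega>]) (intro continuous_intros)
      then have "\<forall>\<^sub>F \<zeta> in nhds 0. \<zeta> \<in> (\<lambda>\<zeta>. L \<zeta> i) -` \<Omega>"
        by (rule eventually_nhds_in_open) (simp add: x L)
      then show ?thesis by simp
    qed
    then have "\<forall>\<^sub>F \<zeta> in nhds 0. \<forall>i. L \<zeta> i \<in> \<Omega>"
      by (rule eventually_all_finite)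
    then obtain r where r: "r > 0" "\<And>\<zeta> i. \<zeta> \<in> ball 0 r \<Longrightarrow> L \<zeta> i \<in> \<Omega>"
      by (auto simp: eventually_nhds_metric dist_commute)
    have "mpoly_eval (L 0) P \<noteq> 0"
    proof (rule Hurwitz_no_zeros[where S = "ball 0 r" and g = "\<lambda>\<zeta>. mpoly_eval (L \<zeta>) P"
          and \<F> = "\<lambda>n \<zeta>. \<Sum>j\<in>J. \<phi> n j * mpoly_eval (L \<zeta>) (p j)"])
      show "(\<lambda>\<zeta>. \<Sum>j\<in>J. \<phi> n j * mpoly_eval (L \<zeta>) (p j)) holomorphic_on ball 0 r" for n
        by (intro holomorphic_intros hol)
      show "uniform_limit K (\<lambda>n \<zeta>. \<Sum>j\<in>J. \<phi> n j * mpoly_eval (L \<zeta>) (p j))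
          (\<lambda>\<zeta>. mpoly_eval (L \<zeta>) P) sequentially" if "compact K" "K \<subseteq> ball 0 r" for K
        unfolding P
      proof (intro uniform_limit_sum uniform_lim_mult)
        fix j assume "j \<in> J"
        show "uniform_limit K (\<lambda>n \<zeta>. \<phi> n j) (\<lambda>\<zeta>. \<phi>\<^sub>0 j) sequentially"
          using lim[OF \<open>j \<in> J\<close>] by (auto simp: uniform_limit_iff tendsto_iff elim: eventually_mono)
        show "bounded ((\<lambda>\<zeta>. mpoly_eval (L \<zeta>) (p j)) ` K)"
          by (intro compact_imp_bounded compact_continuous_image holomorphic_on_imp_continuous_on hol that)
        show "bounded ((\<lambda>\<zeta>. \<phi>\<^sub>0 j) ` K)"
          by (rule finite_imp_bounded) (auto intro: finite_subset[of _ "{\<phi>\<^sub>0 j}"])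
      qed (rule uniform_limit_const)
      show "\<not> (\<lambda>\<zeta>. mpoly_eval (L \<zeta>) P) constant_on ball 0 r"
      proof
        assume "(\<lambda>\<zeta>. mpoly_eval (L \<zeta>) P) constant_on ball 0 r"
        then have "mpoly_eval (L \<zeta>) P = 0" if "\<zeta> \<in> ball 0 r" for \<zeta>
          using that 0 r(1) L(1) by (metis constant_on_def centre_in_ball)
        then have "mpoly_eval (L 1) P = 0"
          using analytic_continuation[OF hol, of UNIV "ball 0 r" 0 P 1] r(1)
          by (auto simp: islimpt_ball)
        then show False using y L by simp
      qed
    qed (use r nz hol in auto)
    then show False using 0 L by simp
  qed
  then show ?thesis by (simp add: stable_def)
qed simp

section \<open>From two variables to several pairs of variables\<close>

text \<open>Suppose that, in each index \<open>i\<close>, a linear functional \<open>\<psi> i\<close> does not vanish where the functionals in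
  \<open>\<Phi> i\<close> do not. Then their tensor product has the same property, since the functionals
  in \<open>\<Phi> i\<close> can be replaced by \<open>\<psi> i\<close> one index at a time: if the other factors are kept fixed, what
  remains is linear in the factor \<open>i\<close>.\<close>

lemma tensor_nonvanishing:
  fixes d :: "('n::finite \<Rightarrow> 'a) \<Rightarrow> complex"
  assumes fin: "\<And>i. finite (A i)"
    and step: "\<And>i C. (\<And>\<phi>. \<phi> \<in> \<Phi> i \<Longrightarrow> (\<Sum>a\<in>A i. C a * \<phi> a) \<noteq> 0) \<Longrightarrow> (\<Sum>a\<in>A i. C a * \<psi> i a) \<noteq> 0"
    and nz: "\<And>\<phi>. (\<And>i. \<phi> i \<in> \<Phi> i) \<Longrightarrow> (\<Sum>\<gamma>\<in>PiE UNIV A. d \<gamma> * (\<Prod>i\<in>UNIV. \<phi> i (\<gamma> i))) \<noteq> 0"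
  shows "(\<Sum>\<gamma>\<in>PiE UNIV A. d \<gamma> * (\<Prod>i\<in>UNIV. \<psi> i (\<gamma> i))) \<noteq> 0"
proof -
  have "(\<Sum>\<gamma>\<in>PiE UNIV A. d \<gamma> * (\<Prod>i\<in>UNIV. \<phi> i (\<gamma> i))) \<noteq> 0"
    if "finite I" "\<And>i. i \<notin> I \<Longrightarrow> \<phi> i \<in> \<Phi> i" "\<And>i. i \<in> I \<Longrightarrow> \<phi> i = \<psi> i" for I \<phi>
    using that
  proof (induction I arbitrary: \<phi> rule: finite_induct)
    case empty
    then show ?case using nz by simp
  next
    case (insert j I)
    \<comment> \<open>summing over all indices but \<open>j\<close>\<close>
    define C where "C a = (\<Sum>\<gamma>\<in>{\<gamma> \<in> PiE UNIV A. \<gamma> j = a}. d \<gamma> * (\<Prod>i\<in>UNIV - {j}. \<phi> i (\<gamma> i)))" for a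
    have split: "(\<Sum>\<gamma>\<in>PiE UNIV A. d \<gamma> * (\<Prod>i\<in>UNIV. (\<phi>(j := \<eta>)) i (\<gamma> i))) = (\<Sum>a\<in>A j. C a * \<eta> a)" for \<eta>
    proof -
      have "(\<Sum>a\<in>A j. C a * \<eta> a) = (\<Sum>a\<in>A j. \<Sum>\<gamma>\<in>{\<gamma> \<in> PiE UNIV A. \<gamma> j = a}.
          d \<gamma> * (\<Prod>i\<in>UNIV. (\<phi>(j := \<eta>)) i (\<gamma> i)))"
        unfolding C_def sum_distrib_right
        by (intro sum.cong refl) (auto simp: prod.remove[of UNIV j] intro!: prod.cong)
      also have "\<dots> = (\<Sum>\<gamma>\<in>PiE UNIV A. d \<gamma> * (\<Prod>i\<in>UNIV. (\<phi>(j := \<eta>)) i (\<gamma> i)))"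
        by (rule sum.group) (auto intro: finite_PiE fin)
      finally show ?thesis ..
    qed
    have "(\<Sum>a\<in>A j. C a * \<psi> j a) \<noteq> 0"
    proof (rule step)
      fix \<eta> assume "\<eta> \<in> \<Phi> j"
      then show "(\<Sum>a\<in>A j. C a * \<eta> a) \<noteq> 0"
        unfolding split[symmetric] using insert by (intro insert.IH) auto
    qed
    then show ?case
      using split[of "\<psi> j"] insert.prems(2)[of j] by (simp add: fun_upd_idem)
  qed
  from this[of UNIV \<psi>] show ?thesis by simp
qed

text \<open>The tensor principle for the Taylor coefficients of \<open>f(u + s, v) g(z + t, w)\<close> at \<open>(u, z)\<close>. The
  functionals in \<open>\<Phi>\<close> are the evaluations at points \<open>(s, t)\<close> of \<open>\<Omega> \<times> \<Omega>\<close>, each given by its values on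
  the monomials; thus the bivariate hypothesis on \<open>\<psi>\<close> suffices.\<close>

lemma composition_nonzero:
  fixes f g :: "('n::finite + 'n) mpoly"
  assumes deg: "\<And>i. degree_in (Inl i) f \<le> \<kappa> i" "\<And>i. degree_in (Inl i) g \<le> \<kappa> i"
    and \<psi>: "\<And>i c. (\<And>s t. s \<in> \<Omega> \<Longrightarrow> t \<in> \<Omega> \<Longrightarrow> (\<Sum>a\<le>\<kappa> i. \<Sum>b\<le>\<kappa> i. c a b * s ^ a * t ^ b) \<noteq> 0)
        \<Longrightarrow> (\<Sum>a\<le>\<kappa> i. \<Sum>b\<le>\<kappa> i. c a b * \<psi> i a b) \<noteq> 0"
    and f: "\<And>s. (\<And>i. s i \<in> \<Omega>) \<Longrightarrow> mpoly_eval (case_sum (\<lambda>i. u i + s i) v) f \<noteq> 0"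
    and g: "\<And>t. (\<And>i. t i \<in> \<Omega>) \<Longrightarrow> mpoly_eval (case_sum (\<lambda>i. z i + t i) w) g \<noteq> 0"
  shows "(\<Sum>(\<alpha>, \<beta>)\<in>{..\<kappa>} \<times> {..\<kappa>}. (\<Prod>i\<in>UNIV. \<psi> i (\<alpha> i) (\<beta> i)) / (multi_fact \<alpha> * multi_fact \<beta>) *
    (mpoly_eval (case_sum u v) (mpoly_diff Inl \<alpha> f) * mpoly_eval (case_sum z w) (mpoly_diff Inl \<beta> g))) \<noteq> 0"
proof -
  define F where "F \<alpha> = mpoly_eval (case_sum u v) (mpoly_diff Inl \<alpha> f) / multi_fact \<alpha>" for \<alpha>
  define G where "G \<beta> = mpoly_eval (case_sum z w) (mpoly_diff Inl \<beta> g) / multi_fact \<beta>" for \<beta>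
  define A where "A i = {..\<kappa> i} \<times> {..\<kappa> i}" for i
  \<comment> \<open>a multi-index of pairs is a pair of multi-indices\<close>
  have reindex: "(\<Sum>\<gamma>\<in>PiE UNIV A. h (fst \<circ> \<gamma>) (snd \<circ> \<gamma>)) = (\<Sum>(\<alpha>, \<beta>)\<in>{..\<kappa>} \<times> {..\<kappa>}. h \<alpha> \<beta>)"
    for h :: "('n \<Rightarrow> nat) \<Rightarrow> ('n \<Rightarrow> nat) \<Rightarrow> complex"
    by (rule sum.reindex_bij_witness[where i = "\<lambda>(\<alpha>, \<beta>) i. (\<alpha> i, \<beta> i)" and j = "\<lambda>\<gamma>. (fst \<circ> \<gamma>, snd \<circ> \<gamma>)"])
      (auto simp: A_def le_fun_def fun_eq_iff PiE_def Pi_def mem_Times_iff)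
  define \<Phi> where "\<Phi> = {(\<lambda>(a, b). s ^ a * t ^ b) | s t. s \<in> \<Omega> \<and> t \<in> \<Omega>}"
  have "(\<Sum>\<gamma>\<in>PiE UNIV A. (F (fst \<circ> \<gamma>) * G (snd \<circ> \<gamma>)) * (\<Prod>i\<in>UNIV. (\<lambda>(a, b). \<psi> i a b) (\<gamma> i))) \<noteq> 0"
  proof (rule tensor_nonvanishing[where \<Phi> = "\<lambda>_. \<Phi>"])
    fix i C
    assume C: "\<And>\<phi>. \<phi> \<in> \<Phi> \<Longrightarrow> (\<Sum>a\<in>A i. C a * \<phi> a) \<noteq> 0"
    have "(\<Sum>a\<le>\<kappa> i. \<Sum>b\<le>\<kappa> i. C (a, b) * \<psi> i a b) \<noteq> 0"
    proof (rule \<psi>)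
      fix s t assume "s \<in> \<Omega>" "t \<in> \<Omega>"
      then have "(\<lambda>(a, b). s ^ a * t ^ b) \<in> \<Phi>" by (auto simp: \<Phi>_def)
      from C[OF this] show "(\<Sum>a\<le>\<kappa> i. \<Sum>b\<le>\<kappa> i. C (a, b) * s ^ a * t ^ b) \<noteq> 0"
        by (simp add: A_def sum.cartesian_product case_prod_unfold mult.assoc)
    qed
    then show "(\<Sum>a\<in>A i. C a * (case a of (a, b) \<Rightarrow> \<psi> i a b)) \<noteq> 0"
      by (simp add: A_def sum.cartesian_product case_prod_unfold)
  next
    fix \<phi> :: "'n \<Rightarrow> nat \<times> nat \<Rightarrow> complex" assume "\<And>i. \<phi> i \<in> \<Phi>"
    then have "\<forall>i. \<exists>s t. \<phi> i = (\<lambda>(a, b). s ^ a * t ^ b) \<and> s \<in> \<Omega> \<and> t \<in> \<Omega>"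
      by (auto simp: \<Phi>_def)
    then obtain s t where \<phi>: "\<And>i. \<phi> i = (\<lambda>(a, b). s i ^ a * t i ^ b)"
      and st: "\<And>i. s i \<in> \<Omega>" "\<And>i. t i \<in> \<Omega>" by metis
    have "(\<Sum>\<gamma>\<in>PiE UNIV A. (F (fst \<circ> \<gamma>) * G (snd \<circ> \<gamma>)) * (\<Prod>i\<in>UNIV. \<phi> i (\<gamma> i)))
      = (\<Sum>(\<alpha>, \<beta>)\<in>{..\<kappa>} \<times> {..\<kappa>}. (F \<alpha> * (\<Prod>i\<in>UNIV. s i ^ \<alpha> i)) * (G \<beta> * (\<Prod>i\<in>UNIV. t i ^ \<beta> i)))"
      unfolding reindex[symmetric] by (simp add: \<phi> case_prod_unfold prod.distrib mult_ac)
    also have "\<dots> = mpoly_eval (case_sum (\<lambda>i. u i + s i) v) f * mpoly_eval (case_sum (\<lambda>i. z i + t i) w) g"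
      unfolding taylor[of f \<kappa>, OF deg(1)] taylor[of g \<kappa>, OF deg(2)] sum_product sum.cartesian_product
      by (simp add: F_def G_def)
    also have "\<dots> \<noteq> 0" using f g st by simp
    finally show "(\<Sum>\<gamma>\<in>PiE UNIV A. (F (fst \<circ> \<gamma>) * G (snd \<circ> \<gamma>)) * (\<Prod>i\<in>UNIV. \<phi> i (\<gamma> i))) \<noteq> 0" .
  qed (simp add: A_def)
  also have "(\<Sum>\<gamma>\<in>PiE UNIV A. (F (fst \<circ> \<gamma>) * G (snd \<circ> \<gamma>)) * (\<Prod>i\<in>UNIV. (\<lambda>(a, b). \<psi> i a b) (\<gamma> i)))
     = (\<Sum>(\<alpha>, \<beta>)\<in>{..\<kappa>} \<times> {..\<kappa>}. F \<alpha> * G \<beta> * (\<Prod>i\<in>UNIV. \<psi> i (\<alpha> i) (\<beta> i)))"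
    unfolding reindex[symmetric] by (simp add: case_prod_unfold)
  finally show ?thesis
    by (simp add: F_def G_def case_prod_unfold mult_ac)
qed

section \<open>The functionals that yield the composition formulas\<close>

text \<open>The value on \<open>s\<^sup>a t\<^sup>b\<close> of the functional of Grace's theorem, after scaling both variables by \<open>r\<close> and
  multiplying by \<open>k!\<close>.\<close>

definition diagonal_weight :: "complex \<Rightarrow> complex \<Rightarrow> nat \<Rightarrow> nat \<Rightarrow> nat \<Rightarrow> complex" where
  "diagonal_weight \<sigma> r k a b = (if b = a then \<sigma> ^ a * r ^ (a + b) * (fact a * fact (k - a)) else 0)"

lemma fact_div_binomial:
  assumes "a \<le> k"
  shows "fact k / of_nat (k choose a) = (fact a * fact (k - a) :: complex)"
  by (simp add: binomial_fact[OF assms])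

text \<open>The scaling by \<open>r\<close> serves the disk: Grace's theorem needs a closed region \<open>\<Omega>'\<close> without zeros, while
  stability in the disk only excludes zeros in the open one.\<close>

lemma diagonal_weight_nonzero:
  assumes "apolar_region \<Omega>' \<sigma>" "\<And>s. s \<in> \<Omega>' \<Longrightarrow> r * s \<in> \<Omega>"
    and nz: "\<And>s t. s \<in> \<Omega> \<Longrightarrow> t \<in> \<Omega> \<Longrightarrow> (\<Sum>a\<le>k. \<Sum>b\<le>k. c a b * s ^ a * t ^ b) \<noteq> 0"
  shows "(\<Sum>a\<le>k. \<Sum>b\<le>k. c a b * diagonal_weight \<sigma> r k a b) \<noteq> 0"
proof -
  have "(\<Sum>a\<le>k. \<sigma> ^ a * (c a a * r ^ (a + a)) / of_nat (k choose a)) \<noteq> 0"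
  proof (rule grace_bivariate[OF assms(1), where c = "\<lambda>a b. c a b * r ^ (a + b)"])
    fix s t assume "s \<in> \<Omega>'" "t \<in> \<Omega>'"
    from nz[OF assms(2)[OF this(1)] assms(2)[OF this(2)]]
    show "(\<Sum>a\<le>k. \<Sum>b\<le>k. (c a b * r ^ (a + b)) * s ^ a * t ^ b) \<noteq> 0"
      by (simp add: power_mult_distrib power_add mult_ac)
  qed
  then have "fact k * (\<Sum>a\<le>k. \<sigma> ^ a * (c a a * r ^ (a + a)) / of_nat (k choose a)) \<noteq> 0"
    by simp
  also have "fact k * (\<Sum>a\<le>k. \<sigma> ^ a * (c a a * r ^ (a + a)) / of_nat (k choose a))
      = (\<Sum>a\<le>k. c a a * (\<sigma> ^ a * r ^ (a + a) * (fact k / of_nat (k choose a))))"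
    by (simp add: sum_distrib_left mult_ac)
  also have "\<dots> = (\<Sum>a\<le>k. c a a * diagonal_weight \<sigma> r k a a)"
    by (rule sum.cong) (auto simp: diagonal_weight_def fact_div_binomial)
  also have "\<dots> = (\<Sum>a\<le>k. \<Sum>b\<le>k. c a b * diagonal_weight \<sigma> r k a b)"
    by (rule sum.cong) (auto simp: diagonal_weight_def if_distrib[of "(*) _"] cong: if_cong)
  finally show ?thesis .
qed

text \<open>The diagonal functional, with \<open>\<sigma> = - 1\<close>, applied to \<open>(t + \<eta>)\<^sup>k G(\<omega> s, - \<omega> / (t + \<eta>))\<close> instead of
  \<open>G(s, t)\<close>. Inverting one variable turns \<open>t\<^sup>b\<close> into \<open>t\<^bsup>k - b\<^esup>\<close>, hence the diagonal into the antidiagonal.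
  The shift \<open>\<eta>\<close> keeps \<open>- 1 / (t + \<eta>)\<close> finite for real \<open>t\<close>, and it is sent to \<open>0\<close> in the end;
  the factor \<open>\<omega>\<close> rotates the upper half-plane. The factor \<open>(- 1 / \<omega>)\<^sup>k\<close> makes the limit
  independent of \<open>\<omega>\<close>.\<close>

definition antidiagonal_weight :: "complex \<Rightarrow> complex \<Rightarrow> nat \<Rightarrow> nat \<Rightarrow> nat \<Rightarrow> complex" where
  "antidiagonal_weight \<omega> \<eta> k a b =
     (- 1 / \<omega>) ^ k * \<omega> ^ (a + b) * (- 1) ^ (a + b) * (fact k / of_nat (k choose a)) *
     of_nat ((k - b) choose a) * \<eta> ^ (k - b - a)"

lemma antidiagonal_weight_nonzero:
  assumes "\<omega> \<noteq> 0" and \<eta>: "Im \<eta> > 0"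
    and nz: "\<And>s t. Im (s / \<omega>) \<ge> 0 \<Longrightarrow> Im (t / \<omega>) \<ge> 0 \<Longrightarrow> (\<Sum>a\<le>k. \<Sum>b\<le>k. c a b * s ^ a * t ^ b) \<noteq> 0"
  shows "(\<Sum>a\<le>k. \<Sum>b\<le>k. c a b * antidiagonal_weight \<omega> \<eta> k a b) \<noteq> 0"
proof -
  \<comment> \<open>the coefficients of \<open>(t + \<eta>)\<^sup>k G(\<omega> s, - \<omega> / (t + \<eta>))\<close>\<close>
  define d where "d a l = (\<Sum>b\<le>k. c a b * \<omega> ^ (a + b) * (- 1) ^ b * of_nat ((k - b) choose l) * \<eta> ^ (k - b - l))" for a l
  have "(\<Sum>a\<le>k. (- 1) ^ a * d a a / of_nat (k choose a)) \<noteq> 0"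
  proof (rule grace_bivariate[OF apolar_region_half_plane, where c = d])
    fix s t :: complex assume st: "s \<in> {z. Im z \<ge> 0}" "t \<in> {z. Im z \<ge> 0}"
    define y where "y = t + \<eta>"
    have y: "Im y > 0" using st \<eta> by (simp add: y_def)
    then have "y \<noteq> 0" by auto
    have bin: "(\<Sum>l\<le>k. of_nat ((k - b) choose l) * \<eta> ^ (k - b - l) * t ^ l) = y ^ k * (1 / y) ^ b" if "b \<le> k" for b
    proof -
      have "y ^ k * (1 / y) ^ b = y ^ (k - b)"
        using that \<open>y \<noteq> 0\<close> by (simp add: power_diff power_one_over)
      also have "\<dots> = (\<Sum>l\<le>k - b. of_nat ((k - b) choose l) * \<eta> ^ (k - b - l) * t ^ l)"
        unfolding y_def by (simp add: binomial_ring mult_ac)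
      also have "\<dots> = (\<Sum>l\<le>k. of_nat ((k - b) choose l) * \<eta> ^ (k - b - l) * t ^ l)"
        by (rule sum.mono_neutral_left) auto
      finally show ?thesis ..
    qed
    have "(\<Sum>a\<le>k. \<Sum>l\<le>k. d a l * s ^ a * t ^ l)
        = (\<Sum>a\<le>k. \<Sum>b\<le>k. c a b * \<omega> ^ (a + b) * (- 1) ^ b * s ^ a *
            (\<Sum>l\<le>k. of_nat ((k - b) choose l) * \<eta> ^ (k - b - l) * t ^ l))"
      unfolding d_def sum_distrib_left sum_distrib_right
      by (rule sum.cong[OF refl], subst sum.swap) (simp add: mult_ac)
    also have "\<dots> = (\<Sum>a\<le>k. \<Sum>b\<le>k. c a b * \<omega> ^ (a + b) * (- 1) ^ b * s ^ a * (y ^ k * (1 / y) ^ b))"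
      by (intro sum.cong refl arg_cong[where f = "(*) _"] bin) simp
    also have "\<dots> = y ^ k * (\<Sum>a\<le>k. \<Sum>b\<le>k. c a b * (\<omega> * s) ^ a * (\<omega> * (- 1 / y)) ^ b)"
      unfolding sum_distrib_left
    proof (intro sum.cong refl)
      fix a b
      have "(- 1 / y) ^ b = (- 1) ^ b * (1 / y) ^ b"
        by (simp flip: power_mult_distrib)
      then show "c a b * \<omega> ^ (a + b) * (- 1) ^ b * s ^ a * (y ^ k * (1 / y) ^ b)
          = y ^ k * (c a b * (\<omega> * s) ^ a * (\<omega> * (- 1 / y)) ^ b)"
        by (simp only: power_mult_distrib power_add mult_ac)
    qed
    also have "\<dots> \<noteq> 0"
    proof -
      have "Im (- 1 / y) \<ge> 0" using y by (simp add: Im_divide)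
      then have "(\<Sum>a\<le>k. \<Sum>b\<le>k. c a b * (\<omega> * s) ^ a * (\<omega> * (- 1 / y)) ^ b) \<noteq> 0"
        using st \<open>\<omega> \<noteq> 0\<close> by (intro nz) auto
      then show ?thesis using \<open>y \<noteq> 0\<close> by simp
    qed
    finally show "(\<Sum>a\<le>k. \<Sum>l\<le>k. d a l * s ^ a * t ^ l) \<noteq> 0" .
  qed
  then have "(- 1 / \<omega>) ^ k * fact k * (\<Sum>a\<le>k. (- 1) ^ a * d a a / of_nat (k choose a)) \<noteq> 0"
    using \<open>\<omega> \<noteq> 0\<close> by simp
  also have "(- 1 / \<omega>) ^ k * fact k * (\<Sum>a\<le>k. (- 1) ^ a * d a a / of_nat (k choose a))
     = (\<Sum>a\<le>k. \<Sum>b\<le>k. c a b * antidiagonal_weight \<omega> \<eta> k a b)"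
    unfolding d_def antidiagonal_weight_def sum_distrib_left sum_divide_distrib
    by (intro sum.cong refl) (simp add: power_add mult_ac)
  finally show ?thesis .
qed

text \<open>Below the antidiagonal a positive power of \<open>\<eta>\<close> remains, above it the binomial coefficient
  vanishes.\<close>

lemma antidiagonal_weight_limit:
  assumes "\<omega> \<noteq> 0" "a \<le> k" "b \<le> k" "\<eta> \<longlonglongrightarrow> 0"
  shows "(\<lambda>n. antidiagonal_weight \<omega> (\<eta> n) k a b) \<longlonglongrightarrow> (if b = k - a then fact a * fact b else 0)"
proof (cases "b = k - a")
  case True
  then have ab: "a + b = k" "k - b = a" using assms by auto
  have "antidiagonal_weight \<omega> z k a b = fact a * fact b" for z
  proof -
    have "antidiagonal_weight \<omega> z k a b = ((- 1 / \<omega>) ^ k * \<omega> ^ k * (- 1) ^ k) * (fact k / of_nat (k choose a))"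
      unfolding antidiagonal_weight_def ab by simp
    also have "(- 1 / \<omega>) ^ k * \<omega> ^ k * (- 1) ^ k = 1"
      using assms(1) by (simp flip: power_mult_distrib)
    finally show ?thesis using True assms(2) by (simp add: fact_div_binomial)
  qed
  then show ?thesis using True by simp
next
  case False
  show ?thesis
  proof (cases "a + b < k")
    case True
    then have "k - b - a > 0" by simp
    then have "(\<lambda>n. \<eta> n ^ (k - b - a)) \<longlonglongrightarrow> 0"
      using tendsto_power[OF assms(4), of "k - b - a"] by (simp add: power_0_left)
    then have "(\<lambda>n. antidiagonal_weight \<omega> (\<eta> n) k a b) \<longlonglongrightarrow> 0"
      unfolding antidiagonal_weight_def by (rule tendsto_mult_right_zero)
    then show ?thesis using False by simp
  next
    case F: False
    then have "k - b < a" using False assms by auto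
    then show ?thesis using False by (simp add: antidiagonal_weight_def binomial_eq_0)
  qed
qed

section \<open>The three composition theorems\<close>

lemma prod_if_eq:
  fixes X :: "'n::finite \<Rightarrow> complex"
  shows "(\<Prod>i\<in>UNIV. if \<beta> i = h i then X i else 0) = (if \<beta> = h then \<Prod>i\<in>UNIV. X i else 0)"
  by (auto simp: fun_eq_iff)

lemma sum_graph:
  fixes h :: "'a \<Rightarrow> 'a" and X :: "'a \<Rightarrow> 'a \<Rightarrow> complex"
  assumes "finite S" "\<And>\<alpha>. \<alpha> \<in> S \<Longrightarrow> h \<alpha> \<in> S"
  shows "(\<Sum>(\<alpha>, \<beta>)\<in>S \<times> S. (if \<beta> = h \<alpha> then c \<alpha> else 0) * X \<alpha> \<beta>) = (\<Sum>\<alpha>\<in>S. c \<alpha> * X \<alpha> (h \<alpha>))"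
proof -
  have "(\<Sum>(\<alpha>, \<beta>)\<in>S \<times> S. (if \<beta> = h \<alpha> then c \<alpha> else 0) * X \<alpha> \<beta>)
    = (\<Sum>\<alpha>\<in>S. \<Sum>\<beta>\<in>S. if \<beta> = h \<alpha> then c \<alpha> * X \<alpha> \<beta> else 0)"
    unfolding sum.cartesian_product by (rule sum.cong) auto
  also have "\<dots> = (\<Sum>\<alpha>\<in>S. c \<alpha> * X \<alpha> (h \<alpha>))"
    using assms by (intro sum.cong refl) simp
  finally show ?thesis .
qed

lemma open_half_plane: "open (half_plane \<theta>)"
  unfolding half_plane_def by (intro open_Collect_less continuous_intros)

text \<open>So at points \<open>u\<close> and \<open>z\<close> of the open half-plane, Grace's theorem applies to the displacements \<open>s\<close> and
  \<open>t\<close> in the closed one.\<close>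

lemma half_plane_add:
  assumes "u \<in> half_plane \<theta>" "Im (s / exp (- (\<i> * of_real \<theta>))) \<ge> 0"
  shows "u + s \<in> half_plane \<theta>"
  using assms by (simp add: half_plane_def exp_minus field_simps)

lemma multi_fact_nonzero [simp]: "multi_fact \<alpha> \<noteq> 0"
  by (simp add: multi_fact_def)

text \<open>The multi-indices with \<open>\<alpha> + \<beta> = \<kappa>\<close> are isolated by the antidiagonal functionals in the limit
  \<open>\<eta> \<longlonglongrightarrow> 0\<close>. Before the limit there are no zeros; the limit itself may vanish identically, for example
  for constant \<open>f\<close> and \<open>g\<close> and \<open>\<kappa> \<noteq> 0\<close>.\<close>

lemma antidiagonal_composition_stable:
  fixes f g :: "('n::finite + 'n) mpoly" and P :: "(('n + 'n) + ('n + 'n)) mpoly"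
  assumes deg: "\<And>i. degree_in (Inl i) f \<le> \<kappa> i" "\<And>i. degree_in (Inl i) g \<le> \<kappa> i"
    and stable: "stable (half_plane \<theta>) f" "stable (half_plane \<theta>) g"
  defines "P \<equiv> (\<Sum>\<alpha>\<in>{..\<kappa>}. rename_vars Inl (mpoly_diff Inl \<alpha> f) * rename_vars Inr (mpoly_diff Inl (\<kappa> - \<alpha>) g))"
  shows "stable (half_plane \<theta>) P \<or> P = 0"
proof -
  define \<omega> where "\<omega> = exp (- (\<i> * complex_of_real \<theta>))"
  have \<omega>: "\<omega> \<noteq> 0" by (simp add: \<omega>_def)
  define \<eta> where "\<eta> n = \<i> * complex_of_real (1 / real (Suc n))" for n
  have \<eta>: "\<eta> \<longlonglongrightarrow> 0" "Im (\<eta> n) > 0" for n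
    unfolding \<eta>_def using tendsto_mult[OF tendsto_const[of \<i>] LIMSEQ_Suc[OF lim_1_over_n]]
    by simp_all
  define \<phi> where "\<phi> n = (\<lambda>(\<alpha>, \<beta>). (\<Prod>i\<in>UNIV. antidiagonal_weight \<omega> (\<eta> n) (\<kappa> i) (\<alpha> i) (\<beta> i)) / (multi_fact \<alpha> * multi_fact \<beta>))" for n
  define \<phi>\<^sub>0 where "\<phi>\<^sub>0 = (\<lambda>(\<alpha>, \<beta>). if \<beta> = \<kappa> - \<alpha> then 1 else 0 :: complex)"
  define p :: "('n \<Rightarrow> nat) \<times> ('n \<Rightarrow> nat) \<Rightarrow> (('n + 'n) + ('n + 'n)) mpoly"
    where "p = (\<lambda>(\<alpha>, \<beta>). rename_vars Inl (mpoly_diff Inl \<alpha> f) * rename_vars Inr (mpoly_diff Inl \<beta> g))"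
  show ?thesis
  proof (rule stable_limit[OF open_half_plane, where J = "{..\<kappa>} \<times> {..\<kappa>}" and \<phi> = \<phi> and \<phi>\<^sub>0 = \<phi>\<^sub>0 and p = p])
    fix x
    have "mpoly_eval x P = (\<Sum>\<alpha>\<in>{..\<kappa>}. mpoly_eval x (p (\<alpha>, \<kappa> - \<alpha>)))"
      by (simp add: P_def p_def mpoly_eval_sum)
    also have "\<dots> = (\<Sum>(\<alpha>, \<beta>)\<in>{..\<kappa>} \<times> {..\<kappa>}. \<phi>\<^sub>0 (\<alpha>, \<beta>) * mpoly_eval x (p (\<alpha>, \<beta>)))"
      unfolding \<phi>\<^sub>0_def prod.case
      by (subst sum_graph[OF finite_atMost_multi_index]) (auto simp: le_fun_def)
    finally show "mpoly_eval x P = (\<Sum>j\<in>{..\<kappa>} \<times> {..\<kappa>}. \<phi>\<^sub>0 j * mpoly_eval x (p j))"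
      by (simp add: case_prod_unfold)
  next
    fix j assume "j \<in> {..\<kappa>} \<times> {..\<kappa>}"
    then obtain \<alpha> \<beta> where j: "j = (\<alpha>, \<beta>)" "\<alpha> \<le> \<kappa>" "\<beta> \<le> \<kappa>" by auto
    have "(\<lambda>n. \<phi> n j) \<longlonglongrightarrow> (\<Prod>i\<in>UNIV. if \<beta> i = (\<kappa> - \<alpha>) i then fact (\<alpha> i) * fact (\<beta> i) else 0)
        / (multi_fact \<alpha> * multi_fact \<beta>)"
      unfolding \<phi>_def j prod.case
      by (intro tendsto_divide tendsto_prod tendsto_const)
        (use antidiagonal_weight_limit[OF \<omega> _ _ \<eta>(1)] j(2,3) in \<open>auto simp: le_fun_def\<close>)
    also have "(\<Prod>i\<in>UNIV. if \<beta> i = (\<kappa> - \<alpha>) i then fact (\<alpha> i) * fact (\<beta> i) else 0)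
        / (multi_fact \<alpha> * multi_fact \<beta>) = \<phi>\<^sub>0 j"
      unfolding prod_if_eq \<phi>\<^sub>0_def j using multi_fact_nonzero[of \<alpha>] multi_fact_nonzero[of \<beta>]
      by (simp add: multi_fact_def prod.distrib fun_diff_def)
    finally show "(\<lambda>n. \<phi> n j) \<longlonglongrightarrow> \<phi>\<^sub>0 j" .
  next
    fix n and x :: "('n + 'n) + ('n + 'n) \<Rightarrow> complex" assume x: "\<And>i. x i \<in> half_plane \<theta>"
    have "(\<Sum>(\<alpha>, \<beta>)\<in>{..\<kappa>} \<times> {..\<kappa>}. (\<Prod>i\<in>UNIV. antidiagonal_weight \<omega> (\<eta> n) (\<kappa> i) (\<alpha> i) (\<beta> i)) / (multi_fact \<alpha> * multi_fact \<beta>) *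
       (mpoly_eval (case_sum (\<lambda>i. x (Inl (Inl i))) (\<lambda>i. x (Inl (Inr i)))) (mpoly_diff Inl \<alpha> f) *
        mpoly_eval (case_sum (\<lambda>i. x (Inr (Inl i))) (\<lambda>i. x (Inr (Inr i)))) (mpoly_diff Inl \<beta> g))) \<noteq> 0"
    proof (rule composition_nonzero[OF deg, where \<Omega> = "{s. Im (s / \<omega>) \<ge> 0}"])
      show "(\<Sum>a\<le>\<kappa> i. \<Sum>b\<le>\<kappa> i. c a b * antidiagonal_weight \<omega> (\<eta> n) (\<kappa> i) a b) \<noteq> 0"
        if "\<And>s t. s \<in> {s. Im (s / \<omega>) \<ge> 0} \<Longrightarrow> t \<in> {s. Im (s / \<omega>) \<ge> 0} \<Longrightarrow> (\<Sum>a\<le>\<kappa> i. \<Sum>b\<le>\<kappa> i. c a b * s ^ a * t ^ b) \<noteq> 0" for i c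
        using that by (intro antidiagonal_weight_nonzero \<omega> \<eta>(2)) auto
    next
      fix s :: "'n \<Rightarrow> complex" assume s: "\<And>i. s i \<in> {s. Im (s / \<omega>) \<ge> 0}"
      show "mpoly_eval (case_sum (\<lambda>i. x (Inl (Inl i)) + s i) (\<lambda>i. x (Inl (Inr i)))) f \<noteq> 0"
        using s x by (intro stable(1)[unfolded stable_def, rule_format])
          (auto simp: \<omega>_def intro: half_plane_add split: sum.split)
      show "mpoly_eval (case_sum (\<lambda>i. x (Inr (Inl i)) + s i) (\<lambda>i. x (Inr (Inr i)))) g \<noteq> 0"
        using s x by (intro stable(2)[unfolded stable_def, rule_format])
          (auto simp: \<omega>_def intro: half_plane_add split: sum.split)
    qed
    moreover have "case_sum (\<lambda>i. x (e (Inl i))) (\<lambda>i. x (e (Inr i))) = (\<lambda>i. x (e i))" for e :: "'n + 'n \<Rightarrow> ('n + 'n) + ('n + 'n)"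
      by (auto simp: fun_eq_iff split: sum.split)
    ultimately show "(\<Sum>j\<in>{..\<kappa>} \<times> {..\<kappa>}. \<phi> n j * mpoly_eval x (p j)) \<noteq> 0"
      by (simp add: \<phi>_def p_def case_prod_unfold mpoly_eval_mult mpoly_eval_rename_vars)
  qed
qed

lemma prod_diagonal_weight:
  assumes "\<alpha> \<le> \<kappa>"
  shows "(\<Prod>i\<in>UNIV. diagonal_weight \<sigma> r (\<kappa> i) (\<alpha> i) (\<beta> i)) / (multi_fact \<alpha> * multi_fact \<beta>) =
    (if \<beta> = \<alpha> then (\<sigma> * r ^ 2) ^ (\<Sum>i\<in>UNIV. \<alpha> i) * (multi_fact (\<kappa> - \<alpha>) / multi_fact \<alpha>) else 0)"
proof -
  have "\<sigma> ^ a * r ^ (a + a) = (\<sigma> * r ^ 2) ^ a" for a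
    by (simp add: power_mult_distrib power_add flip: power_mult mult_2)
  then show ?thesis
    using multi_fact_nonzero[of \<alpha>] unfolding diagonal_weight_def prod_if_eq
    by (auto simp: prod.distrib power_sum multi_fact_def)
qed

text \<open>No limit is taken here: \<open>f(u + s, v)\<close> and \<open>g(z + t, w)\<close> have no zeros for \<open>s\<close> and \<open>t\<close> in the closed
  upper half-plane, to which Grace's theorem with \<open>\<sigma> = - 1\<close> applies directly. Hence the result
  is stable, and never zero.\<close>

lemma signed_composition_stable:
  fixes f g :: "('n::finite + 'n) mpoly" and P :: "(('n + 'n) + ('n + 'n)) mpoly"
  assumes deg: "\<And>i. degree_in (Inl i) f \<le> \<kappa> i" "\<And>i. degree_in (Inl i) g \<le> \<kappa> i"
    and stable: "stable (half_plane 0) f" "stable (half_plane 0) g"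
  defines "P \<equiv> (\<Sum>\<alpha>\<in>{..\<kappa>}. Const (multi_sign \<alpha> * (multi_fact (\<kappa> - \<alpha>) / multi_fact \<alpha>)) *
    rename_vars Inl (mpoly_diff Inl \<alpha> f) * rename_vars Inr (mpoly_diff Inl \<alpha> g))"
  shows "stable (half_plane 0) P"
  unfolding stable_def
proof (intro allI impI)
  fix x :: "('n + 'n) + ('n + 'n) \<Rightarrow> complex" assume x: "\<forall>i. x i \<in> half_plane 0"
  define X where "X \<alpha> \<beta> = mpoly_eval (case_sum (\<lambda>i. x (Inl (Inl i))) (\<lambda>i. x (Inl (Inr i)))) (mpoly_diff Inl \<alpha> f) *
      mpoly_eval (case_sum (\<lambda>i. x (Inr (Inl i))) (\<lambda>i. x (Inr (Inr i)))) (mpoly_diff Inl \<beta> g)" for \<alpha> \<beta>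
  have "(\<Sum>(\<alpha>, \<beta>)\<in>{..\<kappa>} \<times> {..\<kappa>}. (\<Prod>i\<in>UNIV. diagonal_weight (- 1) 1 (\<kappa> i) (\<alpha> i) (\<beta> i)) / (multi_fact \<alpha> * multi_fact \<beta>) * X \<alpha> \<beta>) \<noteq> 0"
    unfolding X_def
  proof (rule composition_nonzero[OF deg, where \<Omega> = "{s. Im s \<ge> 0}"])
    show "(\<Sum>a\<le>\<kappa> i. \<Sum>b\<le>\<kappa> i. c a b * diagonal_weight (- 1) 1 (\<kappa> i) a b) \<noteq> 0"
      if "\<And>s t. s \<in> {s. Im s \<ge> 0} \<Longrightarrow> t \<in> {s. Im s \<ge> 0} \<Longrightarrow> (\<Sum>a\<le>\<kappa> i. \<Sum>b\<le>\<kappa> i. c a b * s ^ a * t ^ b) \<noteq> 0" for i c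
      using that by (intro diagonal_weight_nonzero[OF apolar_region_half_plane, where \<Omega> = "{s. Im s \<ge> 0}"]) auto
  next
    fix s :: "'n \<Rightarrow> complex" assume s: "\<And>i. s i \<in> {s. Im s \<ge> 0}"
    show "mpoly_eval (case_sum (\<lambda>i. x (Inl (Inl i)) + s i) (\<lambda>i. x (Inl (Inr i)))) f \<noteq> 0"
      using s x by (intro stable(1)[unfolded stable_def, rule_format])
        (auto intro: half_plane_add split: sum.split)
    show "mpoly_eval (case_sum (\<lambda>i. x (Inr (Inl i)) + s i) (\<lambda>i. x (Inr (Inr i)))) g \<noteq> 0"
      using s x by (intro stable(2)[unfolded stable_def, rule_format])
        (auto intro: half_plane_add split: sum.split)
  qed
  also have "(\<Sum>(\<alpha>, \<beta>)\<in>{..\<kappa>} \<times> {..\<kappa>}. (\<Prod>i\<in>UNIV. diagonal_weight (- 1) 1 (\<kappa> i) (\<alpha> i) (\<beta> i)) / (multi_fact \<alpha> * multi_fact \<beta>) * X \<alpha> \<beta>)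
    = (\<Sum>(\<alpha>, \<beta>)\<in>{..\<kappa>} \<times> {..\<kappa>}. (if \<beta> = \<alpha> then multi_sign \<alpha> * (multi_fact (\<kappa> - \<alpha>) / multi_fact \<alpha>) else 0) * X \<alpha> \<beta>)"
  proof -
    have "(\<Prod>i\<in>UNIV. diagonal_weight (- 1) 1 (\<kappa> i) (\<alpha> i) (\<beta> i)) / (multi_fact \<alpha> * multi_fact \<beta>) =
        (if \<beta> = \<alpha> then multi_sign \<alpha> * (multi_fact (\<kappa> - \<alpha>) / multi_fact \<alpha>) else 0)" if "\<alpha> \<le> \<kappa>" for \<alpha> \<beta>
      using prod_diagonal_weight[OF that, of "- 1" 1 \<beta>] by (simp add: multi_sign_def)
    then show ?thesis
      by (intro sum.cong refl) (clarify, simp only: prod.case atMost_iff)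
  qed
  also have "\<dots> = (\<Sum>\<alpha>\<in>{..\<kappa>}. multi_sign \<alpha> * (multi_fact (\<kappa> - \<alpha>) / multi_fact \<alpha>) * X \<alpha> \<alpha>)"
    by (rule sum_graph[OF finite_atMost_multi_index])
  also have "\<dots> = mpoly_eval x P"
  proof -
    have "case_sum (\<lambda>i. x (e (Inl i))) (\<lambda>i. x (e (Inr i))) = (\<lambda>i. x (e i))" for e :: "'n + 'n \<Rightarrow> ('n + 'n) + ('n + 'n)"
      by (auto simp: fun_eq_iff split: sum.split)
    then show ?thesis
      by (simp add: P_def X_def mpoly_eval_sum mpoly_eval_mult mpoly_eval_rename_vars mult.assoc)
  qed
  finally show "mpoly_eval x P \<noteq> 0" .
qed

text \<open>Here the expansion is at the origin, and the variables \<open>s\<close> and \<open>t\<close> are those of \<open>f\<close> and \<open>g\<close>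
  themselves. Scaling them by \<open>r < 1\<close> gives polynomials without zeros in the closed disk, so
  Grace's theorem with \<open>\<sigma> = 1\<close> applies, and \<open>r\<close> then tends to \<open>1\<close>.\<close>

lemma disk_composition_stable:
  fixes f g :: "('n::finite + 'n) mpoly" and P :: "('n + 'n) mpoly"
  assumes deg: "\<And>i. degree_in (Inl i) f \<le> \<kappa> i" "\<And>i. degree_in (Inl i) g \<le> \<kappa> i"
    and stable: "stable unit_disk f" "stable unit_disk g"
  defines "P \<equiv> (\<Sum>\<alpha>\<in>{..\<kappa>}. Const (multi_fact (\<kappa> - \<alpha>) / multi_fact \<alpha>) *
    rename_vars Inl (first_block_zero (mpoly_diff Inl \<alpha> f)) * rename_vars Inr (first_block_zero (mpoly_diff Inl \<alpha> g)))"
  shows "stable unit_disk P \<or> P = 0"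
proof -
  define r where "r n = (of_nat n / of_nat (Suc n) :: complex)" for n
  have r: "r \<longlonglongrightarrow> 1"
    unfolding r_def by (rule LIMSEQ_n_over_Suc_n)
  have r_less: "norm (r n) < 1" for n
    by (simp add: r_def norm_divide del: of_nat_Suc)
  define \<phi> where "\<phi> n = (\<lambda>(\<alpha>, \<beta>). (\<Prod>i\<in>UNIV. diagonal_weight 1 (r n) (\<kappa> i) (\<alpha> i) (\<beta> i)) / (multi_fact \<alpha> * multi_fact \<beta>))" for n
  define \<phi>\<^sub>0 where "\<phi>\<^sub>0 = (\<lambda>(\<alpha>, \<beta>). if \<beta> = \<alpha> then multi_fact (\<kappa> - \<alpha>) / multi_fact \<alpha> else 0)"
  define p :: "('n \<Rightarrow> nat) \<times> ('n \<Rightarrow> nat) \<Rightarrow> ('n + 'n) mpoly"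
    where "p = (\<lambda>(\<alpha>, \<beta>). rename_vars Inl (first_block_zero (mpoly_diff Inl \<alpha> f)) *
      rename_vars Inr (first_block_zero (mpoly_diff Inl \<beta> g)))"
  show ?thesis
  proof (rule stable_limit[where J = "{..\<kappa>} \<times> {..\<kappa>}" and \<phi> = \<phi> and \<phi>\<^sub>0 = \<phi>\<^sub>0 and p = p])
    show "open unit_disk" by (simp add: unit_disk_def)
  next
    fix x
    have "mpoly_eval x P = (\<Sum>\<alpha>\<in>{..\<kappa>}. multi_fact (\<kappa> - \<alpha>) / multi_fact \<alpha> * mpoly_eval x (p (\<alpha>, \<alpha>)))"
      by (simp add: P_def p_def mpoly_eval_sum mpoly_eval_mult mult.assoc)
    also have "\<dots> = (\<Sum>(\<alpha>, \<beta>)\<in>{..\<kappa>} \<times> {..\<kappa>}. \<phi>\<^sub>0 (\<alpha>, \<beta>) * mpoly_eval x (p (\<alpha>, \<beta>)))"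
      unfolding \<phi>\<^sub>0_def prod.case
      by (rule sum_graph[OF finite_atMost_multi_index, symmetric])
    finally show "mpoly_eval x P = (\<Sum>j\<in>{..\<kappa>} \<times> {..\<kappa>}. \<phi>\<^sub>0 j * mpoly_eval x (p j))"
      by (simp add: case_prod_unfold)
  next
    fix j assume "j \<in> {..\<kappa>} \<times> {..\<kappa>}"
    then obtain \<alpha> \<beta> where j: "j = (\<alpha>, \<beta>)" "\<alpha> \<le> \<kappa>" by auto
    have "(\<lambda>n. (1 * r n ^ 2) ^ (\<Sum>i\<in>UNIV. \<alpha> i) * (multi_fact (\<kappa> - \<alpha>) / multi_fact \<alpha>))
        \<longlonglongrightarrow> (1 * 1 ^ 2) ^ (\<Sum>i\<in>UNIV. \<alpha> i) * (multi_fact (\<kappa> - \<alpha>) / multi_fact \<alpha>)"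
      by (intro tendsto_intros r)
    then show "(\<lambda>n. \<phi> n j) \<longlonglongrightarrow> \<phi>\<^sub>0 j"
      by (simp add: \<phi>_def \<phi>\<^sub>0_def j prod_diagonal_weight)
  next
    fix n and x :: "'n + 'n \<Rightarrow> complex" assume x: "\<And>i. x i \<in> unit_disk"
    have "(\<Sum>(\<alpha>, \<beta>)\<in>{..\<kappa>} \<times> {..\<kappa>}. (\<Prod>i\<in>UNIV. diagonal_weight 1 (r n) (\<kappa> i) (\<alpha> i) (\<beta> i)) / (multi_fact \<alpha> * multi_fact \<beta>) *
       (mpoly_eval (case_sum (\<lambda>_. 0) (\<lambda>i. x (Inl i))) (mpoly_diff Inl \<alpha> f) *
        mpoly_eval (case_sum (\<lambda>_. 0) (\<lambda>i. x (Inr i))) (mpoly_diff Inl \<beta> g))) \<noteq> 0"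
    proof (rule composition_nonzero[OF deg, where \<Omega> = unit_disk])
      show "(\<Sum>a\<le>\<kappa> i. \<Sum>b\<le>\<kappa> i. c a b * diagonal_weight 1 (r n) (\<kappa> i) a b) \<noteq> 0"
        if "\<And>s t. s \<in> unit_disk \<Longrightarrow> t \<in> unit_disk \<Longrightarrow> (\<Sum>a\<le>\<kappa> i. \<Sum>b\<le>\<kappa> i. c a b * s ^ a * t ^ b) \<noteq> 0" for i c
      proof (rule diagonal_weight_nonzero[OF apolar_region_disc _ that])
        fix s :: complex assume "s \<in> cball 0 1"
        then have "norm (r n) * norm s \<le> norm (r n) * 1" by (intro mult_left_mono) auto
        then show "r n * s \<in> unit_disk" using r_less[of n] by (simp add: unit_disk_def norm_mult)
      qed
    next
      fix s :: "'n \<Rightarrow> complex" assume s: "\<And>i. s i \<in> unit_disk"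
      show "mpoly_eval (case_sum (\<lambda>i. 0 + s i) (\<lambda>i. x (Inl i))) f \<noteq> 0"
        using s x by (intro stable(1)[unfolded stable_def, rule_format]) (auto split: sum.split)
      show "mpoly_eval (case_sum (\<lambda>i. 0 + s i) (\<lambda>i. x (Inr i))) g \<noteq> 0"
        using s x by (intro stable(2)[unfolded stable_def, rule_format]) (auto split: sum.split)
    qed
    then show "(\<Sum>j\<in>{..\<kappa>} \<times> {..\<kappa>}. \<phi> n j * mpoly_eval x (p j)) \<noteq> 0"
      by (simp add: \<phi>_def p_def case_prod_unfold mpoly_eval_mult mpoly_eval_rename_vars mpoly_eval_first_block_zero)
  qed
qed

theorem theorem3p3:
  fixes \<kappa> :: "'n::finite \<Rightarrow> nat"
    and f g :: "('n + 'n) mpoly"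
  assumes "\<And>i. degree_in (Inl i) f \<le> \<kappa> i"
    and "\<And>i. degree_in (Inl i) g \<le> \<kappa> i"
  shows
    "(\<forall>\<theta>. 0 \<le> \<theta> \<and> \<theta> < 2 * pi \<and> stable (half_plane \<theta>) f \<and> stable (half_plane \<theta>) g \<longrightarrow>
        (let P = (\<Sum>\<alpha>\<in>{..\<kappa>}.
              rename_vars Inl (mpoly_diff Inl \<alpha> f) *
              rename_vars Inr (mpoly_diff Inl (\<kappa> - \<alpha>) g)) :: (('n + 'n) + ('n + 'n)) mpoly
         in stable (half_plane \<theta>) P \<or> P = 0))
     \<and>
     (stable (half_plane 0) f \<and> stable (half_plane 0) g \<longrightarrow>
        (let P = (\<Sum>\<alpha>\<in>{..\<kappa>}.
              Const (multi_sign \<alpha> * (multi_fact (\<kappa> - \<alpha>) / multi_fact \<alpha>)) *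
              rename_vars Inl (mpoly_diff Inl \<alpha> f) *
              rename_vars Inr (mpoly_diff Inl \<alpha> g)) :: (('n + 'n) + ('n + 'n)) mpoly
         in stable (half_plane 0) P \<or> P = 0))
     \<and>
     (stable unit_disk f \<and> stable unit_disk g \<longrightarrow>
        (let P = (\<Sum>\<alpha>\<in>{..\<kappa>}.
              Const (multi_fact (\<kappa> - \<alpha>) / multi_fact \<alpha>) *
              rename_vars Inl (first_block_zero (mpoly_diff Inl \<alpha> f)) *
              rename_vars Inr (first_block_zero (mpoly_diff Inl \<alpha> g))) :: ('n + 'n) mpoly
         in stable unit_disk P \<or> P = 0))"
  using antidiagonal_composition_stable[OF assms] signed_composition_stable[OF assms]
    disk_composition_stable[OF assms]
  by (simp add: Let_def)

end
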